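(* Let $K$ be a field, $R=K[[t_1,\ldots,t_m]]$, let $>$ be a $\underline{t}$-local monomial ordering on $\mathrm{Mon}^s(\underline{t},\underline{x})$ and let $g_1,\ldots,g_k\in R[\underline{x}]^s$. Then any $f\in R[\underline{x}]^s$ has a weak division with remainder with respect to $g_1,\ldots,g_k$; that is, there exist $u\in S_>$, $q_1,\ldots,q_k\in R[\underline{x}]$ and $r\in R[\underline{x}]^s$ such that $$u\cdot f=q_1\cdot g_1+\ldots+q_k\cdot g_k+r$$ and (ID1) $\mathrm{lm}_>(f)\geq\mathrm{lm}_>(q_i\cdot g_i)$ for all $i=1,\ldots,k$; (ID2) $\mathrm{lm}_>(g_i)\nmid\mathrm{lm}_>(r)$ for all $i=1,\ldots,k$, unless $r=0$.
   Context: $R[\underline{x}]=K[[t_1,\ldots,t_m]][x_1,\ldots,x_n]$ is the polynomial ring in $\underline{x}=(x_1,\ldots,x_n)$ over the formal power series ring $R$ in $\underline{t}=(t_1,\ldots,t_m)$. $\mathrm{Mon}(\underline{t},\underline{x})=\{\underline{t}^\alpha\underline{x}^\beta\mid\alpha\in\mathbb{N}^m,\beta\in\mathbb{N}^n\}$ and $\mathrm{Mon}^s(\underline{t},\underline{x})=\{\underline{t}^\alpha\underline{x}^\beta e_i\mid \alpha\in\mathbb{N}^m,\beta\in\mathbb{N}^n,1\le i\le s\}$, with $e_i$ the $i$-th unit vector. A module monomial $p$ divides $p'$ if $p'=\underline{t}^\alpha\underline{x}^\beta p$ for some $\alpha,\beta$. A monomial ordering on $\mathrm{Mon}(\underline{t},\underline{x})$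 is a total ordering compatible with multiplication. A monomial ordering on $\mathrm{Mon}^s(\underline{t},\underline{x})$ is a total ordering $>$ such that $p>p'$ implies $\underline{t}^\alpha\underline{x}^\beta p>\underline{t}^\alpha\underline{x}^\beta p'$ for all $\alpha,\beta$, and for which there is a monomial ordering on $\mathrm{Mon}(\underline{t},\underline{x})$ (the induced one, also denoted $>$) such that $\underline{t}^\alpha\underline{x}^\beta>\underline{t}^{\alpha'}\underline{x}^{\beta'}\Leftrightarrow\underline{t}^\alpha\underline{x}^\beta e_i>\underline{t}^{\alpha'}\underline{x}^{\beta'}e_i$ for each $i$. It is $\underline{t}$-local if $t_i<1$ for all $i=1,\ldots,m$ in the induced ordering. For $0\ne f\in R[\underline{x}]^s$, $\mathrm{lm}_>(f)$ is the largest monomial occurring in $f$ with non-zero coefficient and $\mathrm{lt}_>(f)$ is the corresponding term including its coefficient; $\mathrm{lm}_>(0)=\mathrm{lt}_>(0)=0$, and $0$ is regarded as smaller than every monomial and as dividing no monomial. $S_>=\{u\in R[\underline{x}]\mid\mathrm{lt}_>(u)=1\}$ (with respect to the induced ordering on $\mathrm{Mon}(\underline{t},\underline{x})$). *)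

theory Defs
  imports "HOL-Library.Poly_Mapping" "HOL-Library.Product_Plus" "HOL-Analysis.Cartesian_Space"
begin

section \<open>Multivariate formal power series\<close>

text \<open>Variables are indexed by \<^typ>\<open>nat\<close>, and an exponent vector is a finitely supported map
  \<^typ>\<open>nat \<Rightarrow>\<^sub>0 nat\<close>. The ring in the \<open>m\<close> variables with indices in \<open>{..<m}\<close> is the
  carrier \<open>power_series m\<close> below; in this way \<open>m = 0\<close> is covered.\<close>

type_synonym expo = "nat \<Rightarrow>\<^sub>0 nat"

definition expos :: "nat \<Rightarrow> expo set" where
  "expos m = {\<alpha>. Poly_Mapping.keys \<alpha> \<subseteq> {..<m}}"

typedef 'a mfps = "UNIV :: (expo \<Rightarrow> 'a) set"
  morphisms mfps_nth Abs_mfps ..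

setup_lifting type_definition_mfps

lemma mfps_eqI: "(\<And>\<alpha>. mfps_nth a \<alpha> = mfps_nth b \<alpha>) \<Longrightarrow> a = b"
  by transfer auto

lemma finite_expo_splits: "finite {(\<beta>, \<gamma>). \<beta> + \<gamma> = (\<alpha> :: expo)}"
proof -
  let ?F = "{h :: nat \<Rightarrow> nat. \<forall>i. (i \<in> Poly_Mapping.keys \<alpha> \<longrightarrow> h i \<in> {..Max (range (Poly_Mapping.lookup \<alpha>))})
    \<and> (i \<notin> Poly_Mapping.keys \<alpha> \<longrightarrow> h i = 0)}"
  have "finite ?F"
    by (rule finite_set_of_finite_funs) auto
  moreover have "Poly_Mapping.lookup \<beta> \<in> ?F" if "\<beta> + \<gamma> = \<alpha>" for \<beta> \<gamma>
  proof -
    have le: "Poly_Mapping.lookup \<beta> i \<le> Poly_Mapping.lookup \<alpha> i" for i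
      using that by (auto simp: lookup_add)
    have "range (Poly_Mapping.lookup \<alpha>) \<subseteq> insert 0 (Poly_Mapping.lookup \<alpha> ` Poly_Mapping.keys \<alpha>)"
      by (auto simp: in_keys_iff)
    then have "finite (range (Poly_Mapping.lookup \<alpha>))"
      by (rule finite_subset) simp
    then have "Poly_Mapping.lookup \<beta> i \<le> Max (range (Poly_Mapping.lookup \<alpha>))" for i
      by (rule order_trans[OF le Max_ge]) simp_all
    moreover have "Poly_Mapping.lookup \<beta> i = 0" if "i \<notin> Poly_Mapping.keys \<alpha>" for i
      using le[of i] that by (simp add: in_keys_iff)
    ultimately show ?thesis by simp
  qed
  ultimately have "finite {\<beta>. \<exists>\<gamma>. \<beta> + \<gamma> = \<alpha>}"
    by (intro finite_imageD[of Poly_Mapping.lookup] finite_subset[OF _ \<open>finite ?F\<close>])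
      (auto intro: inj_onI poly_mapping_eqI)
  then have "finite ((\<lambda>\<beta>. (\<beta>, \<alpha> - \<beta>)) ` {\<beta>. \<exists>\<gamma>. \<beta> + \<gamma> = \<alpha>})"
    by simp
  then show ?thesis
    by (rule rev_finite_subset) force
qed

instantiation mfps :: (comm_ring_1) comm_ring_1
begin

lift_definition zero_mfps :: "'a mfps" is "\<lambda>_. 0" .

lift_definition one_mfps :: "'a mfps" is "\<lambda>\<alpha>. if \<alpha> = 0 then 1 else 0" .

lift_definition plus_mfps :: "'a mfps \<Rightarrow> 'a mfps \<Rightarrow> 'a mfps" is "\<lambda>a b \<alpha>. a \<alpha> + b \<alpha>" .

lift_definition minus_mfps :: "'a mfps \<Rightarrow> 'a mfps \<Rightarrow> 'a mfps" is "\<lambda>a b \<alpha>. a \<alpha> - b \<alpha>" .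

lift_definition uminus_mfps :: "'a mfps \<Rightarrow> 'a mfps" is "\<lambda>a \<alpha>. - a \<alpha>" .

lift_definition times_mfps :: "'a mfps \<Rightarrow> 'a mfps \<Rightarrow> 'a mfps"
  is "\<lambda>a b \<alpha>. \<Sum>(\<beta>, \<gamma>) \<in> {(\<beta>, \<gamma>). \<beta> + \<gamma> = \<alpha>}. a \<beta> * b \<gamma>" .

instance
proof
  fix a b c :: "'a mfps"
  show "a * b * c = a * (b * c)"
  proof (rule mfps_eqI)
    fix \<alpha>
    let ?S = "\<lambda>\<alpha>::expo. {(\<beta>, \<gamma>). \<beta> + \<gamma> = \<alpha>}"
    have "mfps_nth (a * b * c) \<alpha> =
        (\<Sum>p\<in>?S \<alpha>. \<Sum>q\<in>?S (fst p). mfps_nth a (fst q) * mfps_nth b (snd q) * mfps_nth c (snd p))"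
      by (simp add: times_mfps.rep_eq case_prod_beta sum_distrib_right)
    also have "\<dots> = (\<Sum>(p, q)\<in>Sigma (?S \<alpha>) (\<lambda>p. ?S (fst p)).
        mfps_nth a (fst q) * mfps_nth b (snd q) * mfps_nth c (snd p))"
      by (rule sum.Sigma) (auto simp: finite_expo_splits)
    also have "\<dots> = (\<Sum>(p, q)\<in>Sigma (?S \<alpha>) (\<lambda>p. ?S (snd p)).
        mfps_nth a (fst p) * (mfps_nth b (fst q) * mfps_nth c (snd q)))"
      by (rule sum.reindex_bij_witness
          [where j = "\<lambda>(p, q). ((fst q, snd q + snd p), (snd q, snd p))"
             and i = "\<lambda>(p, q). ((fst p + fst q, snd q), (fst p, fst q))"])
        (auto simp: ac_simps)
    also have "\<dots> = (\<Sum>p\<in>?S \<alpha>. \<Sum>q\<in>?S (snd p).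
        mfps_nth a (fst p) * (mfps_nth b (fst q) * mfps_nth c (snd q)))"
      by (rule sum.Sigma[symmetric]) (auto simp: finite_expo_splits)
    also have "\<dots> = mfps_nth (a * (b * c)) \<alpha>"
      by (simp add: times_mfps.rep_eq case_prod_beta sum_distrib_left)
    finally show "mfps_nth (a * b * c) \<alpha> = mfps_nth (a * (b * c)) \<alpha>" .
  qed
  show "a * b = b * a"
  proof (rule mfps_eqI)
    fix \<alpha>
    show "mfps_nth (a * b) \<alpha> = mfps_nth (b * a) \<alpha>"
      unfolding times_mfps.rep_eq
      by (rule sum.reindex_bij_witness[where i = prod.swap and j = prod.swap])
        (auto simp: ac_simps)
  qed
  show "1 * a = a"
  proof (rule mfps_eqI)
    fix \<alpha>
    have "mfps_nth (1 * a) \<alpha> = (\<Sum>p\<in>{(0, \<alpha>)}. mfps_nth 1 (fst p) * mfps_nth a (snd p))"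
      unfolding times_mfps.rep_eq case_prod_beta
      by (rule sum.mono_neutral_right) (auto simp: finite_expo_splits[unfolded case_prod_beta] one_mfps.rep_eq)
    then show "mfps_nth (1 * a) \<alpha> = mfps_nth a \<alpha>"
      by (simp add: one_mfps.rep_eq)
  qed
  show "(a + b) * c = a * c + b * c"
    by (rule mfps_eqI)
      (simp add: times_mfps.rep_eq plus_mfps.rep_eq case_prod_beta distrib_right sum.distrib)
  show "(0 :: 'a mfps) \<noteq> 1"
    by transfer (metis zero_neq_one)
qed (transfer; simp add: fun_eq_iff ac_simps)+

end

definition power_series :: "nat \<Rightarrow> 'a::comm_ring_1 mfps set" where
  "power_series m = {a. \<forall>\<alpha>. mfps_nth a \<alpha> \<noteq> 0 \<longrightarrow> \<alpha> \<in> expos m}"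


section \<open>The polynomial ring over the power series ring, and free modules over it\<close>

text \<open>\<^typ>\<open>expo \<Rightarrow>\<^sub>0 'a mfps\<close> with the convolution product is the ring of polynomials with power
  series coefficients; the key is the exponent of the variables \<open>x\<close>.\<close>

type_synonym 'a psp = "expo \<Rightarrow>\<^sub>0 'a mfps"

definition psp_ring :: "nat \<Rightarrow> nat \<Rightarrow> 'a::comm_ring_1 psp set" where
  "psp_ring m n = {f. Poly_Mapping.keys f \<subseteq> expos n \<and> (\<forall>\<beta>. Poly_Mapping.lookup f \<beta> \<in> power_series m)}"

definition psp_module :: "nat \<Rightarrow> nat \<Rightarrow> ('a::comm_ring_1 psp ^ 's::finite) set" where
  "psp_module m n = {f. \<forall>i. f $ i \<in> psp_ring m n}"

text \<open>The pair \<open>(\<alpha>, \<beta>)\<close> is the monomial \<open>t\<^sup>\<alpha> x\<^sup>\<beta>\<close>, so that multiplication of monomials is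
  addition of pairs and the monomial 1 is \<open>0\<close>. The module monomial \<open>p e\<^sub>i\<close> is \<open>(p, i)\<close>.\<close>

type_synonym mon = "expo \<times> expo"

definition Mon :: "nat \<Rightarrow> nat \<Rightarrow> mon set" where
  "Mon m n = expos m \<times> expos n"

definition Mon_mod :: "nat \<Rightarrow> nat \<Rightarrow> (mon \<times> 's) set" where
  "Mon_mod m n = Mon m n \<times> UNIV"

definition mon_mult :: "mon \<Rightarrow> mon \<times> 's \<Rightarrow> mon \<times> 's" where
  "mon_mult c p = (c + fst p, snd p)"

definition mon_dvd :: "nat \<Rightarrow> nat \<Rightarrow> mon \<times> 's \<Rightarrow> mon \<times> 's \<Rightarrow> bool" where
  "mon_dvd m n p p' \<longleftrightarrow> (\<exists>c\<in>Mon m n. p' = mon_mult c p)"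

definition psp_coeff :: "'a::comm_ring_1 psp \<Rightarrow> mon \<Rightarrow> 'a" where
  "psp_coeff f p = mfps_nth (Poly_Mapping.lookup f (snd p)) (fst p)"

definition psp_term :: "'a::comm_ring_1 \<Rightarrow> mon \<Rightarrow> 'a psp" where
  "psp_term c p = Poly_Mapping.single (snd p) (Abs_mfps (\<lambda>\<alpha>. if \<alpha> = fst p then c else 0))"

definition psp_supp :: "'a::comm_ring_1 psp \<Rightarrow> mon set" where
  "psp_supp f = {p. psp_coeff f p \<noteq> 0}"

definition mod_supp :: "'a::comm_ring_1 psp ^ 's::finite \<Rightarrow> (mon \<times> 's) set" where
  "mod_supp f = {(p, i). psp_coeff (f $ i) p \<noteq> 0}"


section \<open>Monomial orderings\<close>

text \<open>Orderings are given by their strict relation \<open>gt\<close>, where \<open>gt p p'\<close> means \<open>p > p'\<close>; only its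
  restriction to the monomials in the given variables matters.\<close>

definition strict_total_on :: "'p set \<Rightarrow> ('p \<Rightarrow> 'p \<Rightarrow> bool) \<Rightarrow> bool" where
  "strict_total_on A gt \<longleftrightarrow> irreflp_on A gt \<and> transp_on A gt \<and> totalp_on A gt"

definition monomial_ordering :: "nat \<Rightarrow> nat \<Rightarrow> (mon \<Rightarrow> mon \<Rightarrow> bool) \<Rightarrow> bool" where
  "monomial_ordering m n gt \<longleftrightarrow> strict_total_on (Mon m n) gt \<and>
     (\<forall>c\<in>Mon m n. \<forall>p\<in>Mon m n. \<forall>p'\<in>Mon m n. gt p p' \<longrightarrow> gt (c + p) (c + p'))"

definition induced_ordering ::
  "nat \<Rightarrow> nat \<Rightarrow> (mon \<times> 's \<Rightarrow> mon \<times> 's \<Rightarrow> bool) \<Rightarrow> (mon \<Rightarrow> mon \<Rightarrow> bool) \<Rightarrow> bool" where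
  "induced_ordering m n gt gt1 \<longleftrightarrow> monomial_ordering m n gt1 \<and>
     (\<forall>p\<in>Mon m n. \<forall>p'\<in>Mon m n. \<forall>i. gt1 p p' \<longleftrightarrow> gt (p, i) (p', i))"

definition module_monomial_ordering ::
  "nat \<Rightarrow> nat \<Rightarrow> (mon \<times> 's \<Rightarrow> mon \<times> 's \<Rightarrow> bool) \<Rightarrow> bool" where
  "module_monomial_ordering m n gt \<longleftrightarrow> strict_total_on (Mon_mod m n) gt \<and>
     (\<forall>c\<in>Mon m n. \<forall>p\<in>Mon_mod m n. \<forall>p'\<in>Mon_mod m n.
        gt p p' \<longrightarrow> gt (mon_mult c p) (mon_mult c p')) \<and>
     (\<exists>gt1. induced_ordering m n gt gt1)"

definition t_local :: "nat \<Rightarrow> (mon \<Rightarrow> mon \<Rightarrow> bool) \<Rightarrow> bool" where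
  "t_local m gt1 \<longleftrightarrow> (\<forall>i<m. gt1 0 (Poly_Mapping.single i 1, 0))"


section \<open>Leading monomials and leading terms\<close>

text \<open>Leading monomials are optional: \<^const>\<open>None\<close> stands for the leading monomial \<open>0\<close> of the
  zero element. For a \<open>t\<close>-local ordering, the support of a nonzero element has a greatest element
  although it may be infinite.\<close>

definition greatest_mon :: "('p \<Rightarrow> 'p \<Rightarrow> bool) \<Rightarrow> 'p set \<Rightarrow> 'p option" where
  "greatest_mon gt A =
     (if A = {} then None else Some (THE p. p \<in> A \<and> (\<forall>p'\<in>A. p' \<noteq> p \<longrightarrow> gt p p')))"

definition lm_ring :: "(mon \<Rightarrow> mon \<Rightarrow> bool) \<Rightarrow> 'a::comm_ring_1 psp \<Rightarrow> mon option" where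
  "lm_ring gt1 f = greatest_mon gt1 (psp_supp f)"

definition lt_ring :: "(mon \<Rightarrow> mon \<Rightarrow> bool) \<Rightarrow> 'a::comm_ring_1 psp \<Rightarrow> 'a psp" where
  "lt_ring gt1 f = (case lm_ring gt1 f of None \<Rightarrow> 0 | Some p \<Rightarrow> psp_term (psp_coeff f p) p)"

definition lm ::
  "(mon \<times> 's \<Rightarrow> mon \<times> 's \<Rightarrow> bool) \<Rightarrow> 'a::comm_ring_1 psp ^ 's::finite \<Rightarrow> (mon \<times> 's) option" where
  "lm gt f = greatest_mon gt (mod_supp f)"

fun lm_ge :: "('p \<Rightarrow> 'p \<Rightarrow> bool) \<Rightarrow> 'p option \<Rightarrow> 'p option \<Rightarrow> bool" where
  "lm_ge gt _ None = True"
| "lm_ge gt None (Some _) = False"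
| "lm_ge gt (Some p) (Some p') = (p = p' \<or> gt p p')"

fun lm_dvd :: "nat \<Rightarrow> nat \<Rightarrow> (mon \<times> 's) option \<Rightarrow> (mon \<times> 's) option \<Rightarrow> bool" where
  "lm_dvd m n (Some p) (Some p') = mon_dvd m n p p'"
| "lm_dvd m n None (Some _) = False"
| "lm_dvd m n _ None = True"

definition S_gt :: "nat \<Rightarrow> nat \<Rightarrow> (mon \<Rightarrow> mon \<Rightarrow> bool) \<Rightarrow> 'a::comm_ring_1 psp set" where
  "S_gt m n gt1 = {u \<in> psp_ring m n. lt_ring gt1 u = 1}"

end

theory Submission
  imports Defs
begin

text \<open>The proof is Mora's tangent cone algorithm, turned into an existence argument. A
  \<^emph>\<open>partial remainder\<close> is an element \<open>r\<close> with \<open>(1 + b) f = \<Sum>\<^sub>j q\<^sub>j g\<^sub>j + r\<close>, where all monomials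
  of \<open>b\<close> are smaller than \<open>1\<close> and all monomials of the \<open>q\<^sub>j g\<^sub>j\<close> are at most \<open>lm(f)\<close>. A partial
  remainder that is \<open>0\<close> or whose leading monomial no \<open>lm(g\<^sub>j)\<close> divides is what is wanted. Reducing
  the leading monomial by some \<open>g\<^sub>j\<close> leads to a new partial remainder with a smaller leading
  monomial, but such reductions may go on forever, for two reasons.

  First, already for a bounded degree in the variables \<open>x\<close> there are infinite descending chains of
  monomials. There are no infinite ascending ones, however: of infinitely many monomials of bounded
  \<open>x\<close>-degree, by Dickson's lemma, an earlier one divides a later one with a quotient \<open>t\<^sup>\<alpha>\<close>, and
  \<open>t\<^sup>\<alpha> \<le> 1\<close> (lemma \<open>wf_bounded_mons\<close>). Hence all reductions that respect a bound on the
  \<open>x\<close>-degree can be carried out at once, by well-founded recursion from larger to smaller monomials.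
  The monomial \<open>p\<close> is affected only by multipliers that divide it, which are finitely many; so no
  convergence argument is needed, even if infinitely many monomials lie between two others
  (lemma \<open>determinate_division\<close>).

  Second, reduction by \<open>g\<^sub>j\<close> may raise the \<open>x\<close>-degree again and again. Mora's remedy is to reduce
  also by earlier partial remainders \<open>h\<close>. If \<open>r\<close> has smaller leading monomial than \<open>h\<close>, then the
  multipliers are smaller than \<open>1\<close>, so that subtracting multiples of \<open>h\<close> from \<open>r\<close> changes \<open>1 + b\<close>
  only by monomials smaller than \<open>1\<close> (lemma \<open>partial_rems_diff_below_one\<close>). Suppose that
  every partial remainder were reducible by some \<open>g\<^sub>j\<close>. Alternate one reduction by \<open>g\<^sub>j\<close>, for
  which the degree bound may grow, with a full division by all earlier partial remainders within the
  current bound. This yields partial remainders \<open>r\<^sub>0, r\<^sub>1, \<dots>\<close> with degree bounds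
  \<open>d\<^sub>0, d\<^sub>1, \<dots>\<close>. By Dickson's lemma there are \<open>i < j\<close> such that \<open>lm(r\<^sub>i)\<close> divides \<open>lm(r\<^sub>j)\<close>
  and the ecart \<open>d\<^sub>i - deg\<^sub>x lm(r\<^sub>i)\<close> is at most \<open>d\<^sub>j - deg\<^sub>x lm(r\<^sub>j)\<close>. But then \<open>lm(r\<^sub>j)\<close> could
  have been reduced by \<open>r\<^sub>i\<close> within the bound \<open>d\<^sub>j\<close>, a contradiction
  (lemma \<open>ex_irreducible\<close>).\<close>


section \<open>Monotone subsequences\<close>

lemma incseq_subseq_nat:
  fixes a :: "nat \<Rightarrow> nat"
  shows "\<exists>s. strict_mono s \<and> incseq (\<lambda>k. a (s k))"
proof -
  obtain s :: "nat \<Rightarrow> nat" where s: "strict_mono s" "monoseq (\<lambda>k. a (s k))"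
    using seq_monosub by blast
  show ?thesis
  proof (cases "incseq (\<lambda>k. a (s k))")
    case False
    then have dec: "decseq (\<lambda>k. a (s k))"
      using s(2) by (auto simp: monoseq_iff)
    obtain N where N: "\<And>k. a (s N) \<le> a (s k)"
      using ex_has_least_nat[of "\<lambda>_. True" 0 "\<lambda>k. a (s k)"] by auto
    have "a (s (k + N)) = a (s N)" for k
      using N[of "k + N"] decseqD[OF dec, of N "k + N"] by simp
    moreover have "strict_mono (\<lambda>k. s (k + N))"
      using s(1) by (auto simp: strict_mono_def)
    ultimately show ?thesis
      by (intro exI[of _ "\<lambda>k. s (k + N)"]) (simp add: incseq_def)
  qed (use s in blast)
qed

lemma finite_family_incseq_subseq:
  fixes a :: "'i \<Rightarrow> nat \<Rightarrow> nat"
  assumes "finite I"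
  shows "\<exists>s. strict_mono s \<and> (\<forall>i\<in>I. incseq (\<lambda>k. a i (s k)))"
  using assms
proof (induction I rule: finite_induct)
  case empty
  show ?case
    by (intro exI[of _ id]) (simp add: strict_mono_def)
next
  case (insert i I)
  then obtain s where s: "strict_mono s" "\<And>j. j \<in> I \<Longrightarrow> incseq (\<lambda>k. a j (s k))"
    by blast
  obtain s' where s': "strict_mono s'" "incseq (\<lambda>k. a i (s (s' k)))"
    using incseq_subseq_nat[of "\<lambda>k. a i (s k)"] by blast
  have "strict_mono (\<lambda>k. s (s' k))"
    using s(1) s'(1) by (simp add: strict_mono_def)
  moreover have "incseq (\<lambda>k. a j (s (s' k)))" if "j \<in> I" for j
    using s(2)[OF that] s'(1) by (simp add: incseq_def strict_mono_less_eq)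
  ultimately show ?case
    using s'(2) by (intro exI[of _ "\<lambda>k. s (s' k)"]) auto
qed

text \<open>The finite colouring \<open>c\<close> allows some coordinates to be equal rather than only comparable,
  which is needed for the unit vectors and, when only the variables \<open>t\<close> are small, for the
  exponents of \<open>x\<close>.\<close>

lemma Dickson_sequence:
  fixes a :: "'i \<Rightarrow> nat \<Rightarrow> nat" and c :: "nat \<Rightarrow> 'c"
  assumes "finite I" "finite (range c)"
  obtains i j where "i < j" "c i = c j" "\<And>l. l \<in> I \<Longrightarrow> a l i \<le> a l j"
proof -
  obtain s where s: "strict_mono s" "\<And>l. l \<in> I \<Longrightarrow> incseq (\<lambda>k. a l (s k))"
    using finite_family_incseq_subseq[OF assms(1)] by blast
  have "finite (range (\<lambda>k. c (s k)))"
    using assms(2) by (rule rev_finite_subset) auto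
  then have "\<not> inj (\<lambda>k. c (s k))"
    using finite_imageD infinite_UNIV_nat by blast
  then obtain k l where "k < l" "c (s k) = c (s l)"
    unfolding inj_def by (metis nat_neq_iff)
  with s show thesis
    by (intro that[of "s k" "s l"]) (auto simp: strict_mono_less incseq_def)
qed


section \<open>Coefficients and supports\<close>

lemma psp_eqI: "(\<And>p. psp_coeff f p = psp_coeff g p) \<Longrightarrow> f = g"
  by (rule poly_mapping_eqI, rule mfps_eqI) (metis psp_coeff_def fst_conv snd_conv)

lemma psp_coeff_add [simp]: "psp_coeff (f + g) p = psp_coeff f p + psp_coeff g p"
  by (simp add: psp_coeff_def lookup_add plus_mfps.rep_eq)

lemma psp_coeff_uminus [simp]: "psp_coeff (- f) p = - psp_coeff f p"
  by (simp add: psp_coeff_def lookup_uminus uminus_mfps.rep_eq)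

lemma psp_coeff_diff [simp]: "psp_coeff (f - g) p = psp_coeff f p - psp_coeff g p"
  by (simp add: psp_coeff_def lookup_minus minus_mfps.rep_eq)

lemma psp_coeff_zero [simp]: "psp_coeff 0 p = 0"
  by (simp add: psp_coeff_def zero_mfps.rep_eq)

lemma psp_coeff_one: "psp_coeff 1 p = (if p = 0 then 1 else 0)"
  by (cases p)
    (auto simp: psp_coeff_def lookup_one one_mfps.rep_eq zero_mfps.rep_eq zero_prod_def when_def)

lemma psp_coeff_sum [simp]: "psp_coeff (\<Sum>x\<in>A. F x) p = (\<Sum>x\<in>A. psp_coeff (F x) p)"
  by (induction A rule: infinite_finite_induct) auto

definition mon_splits :: "mon \<Rightarrow> (mon \<times> mon) set" where
  "mon_splits p = {(c, c'). c + c' = p}"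

lemma finite_mon_splits: "finite (mon_splits p)"
proof -
  have "mon_splits p \<subseteq> (\<lambda>((\<alpha>, \<alpha>'), (\<beta>, \<beta>')). ((\<alpha>, \<beta>), (\<alpha>', \<beta>'))) `
      ({(\<alpha>, \<alpha>'). \<alpha> + \<alpha>' = fst p} \<times> {(\<beta>, \<beta>'). \<beta> + \<beta>' = snd p})"
    by (force simp: mon_splits_def image_def)
  then show ?thesis
    by (rule finite_subset) (simp add: finite_expo_splits)
qed

lemma mfps_nth_sum: "mfps_nth (\<Sum>x\<in>A. F x) \<alpha> = (\<Sum>x\<in>A. mfps_nth (F x) \<alpha>)"
  by (induction A rule: infinite_finite_induct) (auto simp: zero_mfps.rep_eq plus_mfps.rep_eq)

lemma lookup_mult_splits:
  fixes f g :: "'a::comm_ring_1 psp"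
  shows "Poly_Mapping.lookup (f * g) \<beta> =
    (\<Sum>(\<gamma>, \<delta>)\<in>{(\<gamma>, \<delta>). \<gamma> + \<delta> = \<beta>}. Poly_Mapping.lookup f \<gamma> * Poly_Mapping.lookup g \<delta>)"
proof -
  have fin: "finite {\<gamma>. \<exists>\<delta>. \<gamma> + \<delta> = \<beta>}"
    by (rule finite_subset[OF _ finite_imageI[OF finite_expo_splits[of \<beta>], of fst]]) force
  have "Poly_Mapping.lookup (f * g) \<beta> =
      (\<Sum>\<gamma>\<in>{\<gamma>. \<exists>\<delta>. \<gamma> + \<delta> = \<beta>}. Poly_Mapping.lookup f \<gamma> * Poly_Mapping.lookup g (\<beta> - \<gamma>))"
  proof -
    have inner: "(\<Sum>\<delta>. Poly_Mapping.lookup g \<delta> when \<beta> = \<gamma> + \<delta>) =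
        (if \<exists>\<delta>. \<gamma> + \<delta> = \<beta> then Poly_Mapping.lookup g (\<beta> - \<gamma>) else 0)" for \<gamma>
    proof (cases "\<exists>\<delta>. \<gamma> + \<delta> = \<beta>")
      case True
      then have "\<beta> = \<gamma> + \<delta> \<longleftrightarrow> \<delta> = \<beta> - \<gamma>" for \<delta>
        by auto
      with True show ?thesis
        by simp
    next
      case False
      then have "\<beta> \<noteq> \<gamma> + \<delta>" for \<delta>
        by metis
      with False show ?thesis
        by simp
    qed
    show ?thesis
      unfolding times_poly_mapping.rep_eq prod_fun_def inner
      using fin by (subst Sum_any.expand_superset[OF fin]) (auto intro!: sum.cong)
  qed
  also have "\<dots> = (\<Sum>(\<gamma>, \<delta>)\<in>{(\<gamma>, \<delta>). \<gamma> + \<delta> = \<beta>}. Poly_Mapping.lookup f \<gamma> * Poly_Mapping.lookup g \<delta>)"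
    by (rule sum.reindex_bij_witness[where i = fst and j = "\<lambda>\<gamma>. (\<gamma>, \<beta> - \<gamma>)"]) auto
  finally show ?thesis .
qed

lemma psp_coeff_mult:
  "psp_coeff (f * g) p = (\<Sum>(c, c')\<in>mon_splits p. psp_coeff f c * psp_coeff g c')"
proof -
  have "psp_coeff (f * g) p = (\<Sum>b\<in>{(\<gamma>, \<delta>). \<gamma> + \<delta> = snd p}. \<Sum>a\<in>{(\<gamma>, \<delta>). \<gamma> + \<delta> = fst p}.
      psp_coeff f (fst a, fst b) * psp_coeff g (snd a, snd b))"
    by (simp add: psp_coeff_def lookup_mult_splits mfps_nth_sum times_mfps.rep_eq case_prod_beta)
  also have "\<dots> = (\<Sum>(b, a)\<in>{(\<gamma>, \<delta>). \<gamma> + \<delta> = snd p} \<times> {(\<gamma>, \<delta>). \<gamma> + \<delta> = fst p}.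
      psp_coeff f (fst a, fst b) * psp_coeff g (snd a, snd b))"
    by (simp add: sum.cartesian_product)
  also have "\<dots> = (\<Sum>(c, c')\<in>mon_splits p. psp_coeff f c * psp_coeff g c')"
    by (rule sum.reindex_bij_witness
        [where j = "\<lambda>(b, a). ((fst a, fst b), (snd a, snd b))"
           and i = "\<lambda>(c, c'). ((snd c, snd c'), (fst c, fst c'))"])
      (auto simp: mon_splits_def)
  finally show ?thesis .
qed

lemma psp_supp_mult:
  assumes "p \<in> psp_supp (f * g)"
  obtains c c' where "c \<in> psp_supp f" "c' \<in> psp_supp g" "p = c + c'"
proof -
  have "(\<Sum>(c, c')\<in>mon_splits p. psp_coeff f c * psp_coeff g c') \<noteq> 0"
    using assms by (simp add: psp_supp_def psp_coeff_mult)
  then obtain x where "x \<in> mon_splits p" "(case x of (c, c') \<Rightarrow> psp_coeff f c * psp_coeff g c') \<noteq> 0"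
    by (rule sum.not_neutral_contains_not_neutral)
  then have "p = fst x + snd x" "psp_coeff f (fst x) \<noteq> 0" "psp_coeff g (snd x) \<noteq> 0"
    by (auto simp: mon_splits_def case_prod_beta)
  then show thesis
    by (intro that[of "fst x" "snd x"]) (simp_all add: psp_supp_def)
qed

text \<open>Infinitely many exponents of \<open>t\<close> may occur in \<open>a\<close>; the finiteness needed for
  \<^const>\<open>Abs_poly_mapping\<close> concerns the exponents of \<open>x\<close> alone.\<close>

definition psp_of :: "(mon \<Rightarrow> 'a) \<Rightarrow> 'a::comm_ring_1 psp" where
  "psp_of a = Abs_poly_mapping (\<lambda>\<beta>. Abs_mfps (\<lambda>\<alpha>. a (\<alpha>, \<beta>)))"

lemma psp_coeff_psp_of:
  assumes "finite B" "\<And>p. a p \<noteq> 0 \<Longrightarrow> snd p \<in> B"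
  shows "psp_coeff (psp_of a) p = a p"
proof -
  have "Abs_mfps (\<lambda>\<alpha>. a (\<alpha>, \<beta>)) = 0" if "\<beta> \<notin> B" for \<beta>
    using assms(2)[of "(_, \<beta>)"] that
    by (intro mfps_eqI) (auto simp: Abs_mfps_inverse zero_mfps.rep_eq)
  then have "finite {\<beta>. Abs_mfps (\<lambda>\<alpha>. a (\<alpha>, \<beta>)) \<noteq> 0}"
    using assms(1) by (blast intro: rev_finite_subset)
  then show ?thesis
    by (simp add: psp_of_def psp_coeff_def Abs_poly_mapping_inverse Abs_mfps_inverse)
qed

text \<open>From here on, elements of the ring and of the module are handled only through their
  coefficients at monomials, never through the nesting of power series inside polynomials.\<close>

lemma psp_ring_iff: "f \<in> psp_ring m n \<longleftrightarrow> psp_supp f \<subseteq> Mon m n"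
proof
  assume "f \<in> psp_ring m n"
  then show "psp_supp f \<subseteq> Mon m n"
    by (force simp: psp_ring_def psp_supp_def psp_coeff_def Mon_def power_series_def in_keys_iff
        zero_mfps.rep_eq)
next
  assume sub: "psp_supp f \<subseteq> Mon m n"
  have sub': "\<alpha> \<in> expos m \<and> \<beta> \<in> expos n"
    if "mfps_nth (Poly_Mapping.lookup f \<beta>) \<alpha> \<noteq> 0" for \<alpha> \<beta>
    using sub that by (force simp: psp_supp_def psp_coeff_def Mon_def)
  have "\<beta> \<in> expos n" if "\<beta> \<in> Poly_Mapping.keys f" for \<beta>
  proof -
    obtain \<alpha> where "mfps_nth (Poly_Mapping.lookup f \<beta>) \<alpha> \<noteq> 0"
      using \<open>\<beta> \<in> _\<close> mfps_eqI[of "Poly_Mapping.lookup f \<beta>" 0]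
      by (auto simp: in_keys_iff zero_mfps.rep_eq)
    then show ?thesis using sub' by blast
  qed
  with sub' show "f \<in> psp_ring m n"
    by (auto simp: psp_ring_def power_series_def)
qed

abbreviation mod_coeff :: "'a::comm_ring_1 psp ^ 's::finite \<Rightarrow> mon \<times> 's \<Rightarrow> 'a" where
  "mod_coeff f p \<equiv> psp_coeff (f $ snd p) (fst p)"

lemma mod_supp_iff: "p \<in> mod_supp f \<longleftrightarrow> mod_coeff f p \<noteq> 0"
  by (auto simp: mod_supp_def case_prod_beta)

lemma mod_eqI: "(\<And>p. mod_coeff f p = mod_coeff g p) \<Longrightarrow> f = g"
  by (simp add: vec_eq_iff) (metis psp_eqI fst_conv snd_conv)

lemma mod_supp_eq_empty_iff: "mod_supp f = {} \<longleftrightarrow> f = 0"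
proof
  assume "mod_supp f = {}"
  then have "mod_coeff f p = 0" for p
    using mod_supp_iff[of p f] by auto
  then show "f = 0"
    by (intro mod_eqI) simp
qed (auto simp: mod_supp_def)

lemma mod_supp_zero [simp]: "mod_supp 0 = {}"
  by (simp add: mod_supp_eq_empty_iff)

lemma psp_module_iff: "f \<in> psp_module m n \<longleftrightarrow> mod_supp f \<subseteq> Mon_mod m n"
  by (auto simp: psp_module_def psp_ring_iff mod_supp_def psp_supp_def Mon_mod_def)

lemma mod_supp_add: "mod_supp (f + g) \<subseteq> mod_supp f \<union> mod_supp g"
  by (auto simp: mod_supp_iff)

lemma mod_supp_diff: "mod_supp (f - g) \<subseteq> mod_supp f \<union> mod_supp g"
  by (auto simp: mod_supp_iff)

lemma mod_supp_smult:
  assumes "p \<in> mod_supp (a *s f)"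
  obtains c p' where "c \<in> psp_supp a" "p' \<in> mod_supp f" "p = mon_mult c p'"
proof -
  have "fst p \<in> psp_supp (a * f $ snd p)"
    using assms by (simp add: mod_supp_iff psp_supp_def)
  then obtain c c' where "c \<in> psp_supp a" "c' \<in> psp_supp (f $ snd p)" "fst p = c + c'"
    by (rule psp_supp_mult)
  then show thesis
    by (intro that[of c "(c', snd p)"])
      (simp_all add: mod_supp_iff psp_supp_def mon_mult_def prod_eq_iff)
qed

lemma mod_coeff_smult:
  "mod_coeff (a *s f) p = (\<Sum>(c, c')\<in>mon_splits (fst p). psp_coeff a c * mod_coeff f (c', snd p))"
  by (simp add: psp_coeff_mult)

lemma expos_add: "\<alpha> \<in> expos m \<Longrightarrow> \<alpha>' \<in> expos m \<Longrightarrow> \<alpha> + \<alpha>' \<in> expos m"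
  using Poly_Mapping.keys_add[of \<alpha> \<alpha>'] by (auto simp: expos_def)

lemma expos_diff: "\<alpha> \<in> expos m \<Longrightarrow> \<alpha> - \<alpha>' \<in> expos m"
  by (auto simp: expos_def in_keys_iff lookup_minus subset_iff)

lemma zero_expos [simp]: "0 \<in> expos m"
  by (simp add: expos_def)

lemma zero_Mon [simp]: "0 \<in> Mon m n"
  by (simp add: Mon_def zero_prod_def)

lemma Mon_add: "c \<in> Mon m n \<Longrightarrow> c' \<in> Mon m n \<Longrightarrow> c + c' \<in> Mon m n"
  by (auto simp: Mon_def expos_add)

lemma mon_mult_mem: "c \<in> Mon m n \<Longrightarrow> p \<in> Mon_mod m n \<Longrightarrow> mon_mult c p \<in> Mon_mod m n"
  by (auto simp: Mon_mod_def mon_mult_def Mon_add)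

lemma mon_mult_zero [simp]: "mon_mult 0 p = p"
  by (simp add: mon_mult_def)

lemma psp_ring_zero: "0 \<in> psp_ring m n"
  by (simp add: psp_ring_iff psp_supp_def)

lemma psp_ring_uminus: "a \<in> psp_ring m n \<Longrightarrow> - a \<in> psp_ring m n"
  by (simp add: psp_ring_iff psp_supp_def)

lemma psp_ring_add:
  assumes "a \<in> psp_ring m n" "b \<in> psp_ring m n"
  shows "a + b \<in> psp_ring m n"
proof -
  have "psp_supp (a + b) \<subseteq> psp_supp a \<union> psp_supp b"
    by (auto simp: psp_supp_def)
  with assms show ?thesis
    unfolding psp_ring_iff by blast
qed

lemma psp_ring_mult: "a \<in> psp_ring m n \<Longrightarrow> b \<in> psp_ring m n \<Longrightarrow> a * b \<in> psp_ring m n"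
  unfolding psp_ring_iff by (blast elim: psp_supp_mult intro: Mon_add)

lemma psp_module_smult:
  "a \<in> psp_ring m n \<Longrightarrow> h \<in> psp_module m n \<Longrightarrow> a *s h \<in> psp_module m n"
  unfolding psp_ring_iff psp_module_iff by (blast elim: mod_supp_smult intro: mon_mult_mem)

lemma psp_module_diff:
  "h \<in> psp_module m n \<Longrightarrow> h' \<in> psp_module m n \<Longrightarrow> h - h' \<in> psp_module m n"
  unfolding psp_module_iff using mod_supp_diff[of h h'] by blast

text \<open>Summing over the fixed range \<open>{..<n}\<close> instead of the keys makes the degree additive by
  definition.\<close>

definition xdeg :: "nat \<Rightarrow> expo \<Rightarrow> nat" where
  "xdeg n \<beta> = (\<Sum>i<n. Poly_Mapping.lookup \<beta> i)"

lemma xdeg_add [simp]: "xdeg n (\<beta> + \<gamma>) = xdeg n \<beta> + xdeg n \<gamma>"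
  by (simp add: xdeg_def lookup_add sum.distrib)

lemma lookup_le_xdeg: "i < n \<Longrightarrow> Poly_Mapping.lookup \<beta> i \<le> xdeg n \<beta>"
  unfolding xdeg_def by (intro member_le_sum) auto

lemma xdeg_pos:
  assumes "\<beta> \<in> expos n" "\<beta> \<noteq> 0"
  shows "xdeg n \<beta> > 0"
proof -
  obtain i where i: "i \<in> Poly_Mapping.keys \<beta>"
    using assms(2) by (metis all_not_in_conv keys_eq_empty)
  then have "i < n"
    using assms(1) by (auto simp: expos_def)
  moreover have "Poly_Mapping.lookup \<beta> i \<noteq> 0"
    using i by (simp add: in_keys_iff)
  ultimately show ?thesis
    using lookup_le_xdeg[of i n \<beta>] by simp
qed

lemma finite_xdeg_le: "finite {\<beta> \<in> expos n. xdeg n \<beta> \<le> d}"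
proof -
  let ?F = "{h :: nat \<Rightarrow> nat. \<forall>i. (i \<in> {..<n} \<longrightarrow> h i \<in> {..d}) \<and> (i \<notin> {..<n} \<longrightarrow> h i = 0)}"
  have "finite ?F"
    by (rule finite_set_of_finite_funs) auto
  moreover have "Poly_Mapping.lookup ` {\<beta> \<in> expos n. xdeg n \<beta> \<le> d} \<subseteq> ?F"
  proof clarify
    fix \<beta> i assume \<beta>: "\<beta> \<in> expos n" "xdeg n \<beta> \<le> d"
    with lookup_le_xdeg[of i n \<beta>] show "(i \<in> {..<n} \<longrightarrow> Poly_Mapping.lookup \<beta> i \<in> {..d}) \<and>
        (i \<notin> {..<n} \<longrightarrow> Poly_Mapping.lookup \<beta> i = 0)"
      by (auto simp: expos_def in_keys_iff)
  qed
  ultimately have "finite (Poly_Mapping.lookup ` {\<beta> \<in> expos n. xdeg n \<beta> \<le> d})"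
    by (rule rev_finite_subset)
  then show ?thesis
    by (rule finite_imageD) (auto intro: inj_onI poly_mapping_eqI)
qed

lemma expo_diff_add:
  fixes \<alpha> \<alpha>' :: expo
  assumes "\<alpha>' \<in> expos m" "\<And>i. i < m \<Longrightarrow> Poly_Mapping.lookup \<alpha>' i \<le> Poly_Mapping.lookup \<alpha> i"
  shows "\<alpha> - \<alpha>' + \<alpha>' = \<alpha>"
proof (rule poly_mapping_eqI)
  fix i
  have "Poly_Mapping.lookup \<alpha>' i = 0" if "\<not> i < m"
    using assms(1) that by (auto simp: expos_def in_keys_iff)
  then show "Poly_Mapping.lookup (\<alpha> - \<alpha>' + \<alpha>') i = Poly_Mapping.lookup \<alpha> i"
    using assms(2) by (cases "i < m") (auto simp: lookup_add lookup_minus)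
qed


section \<open>Monomial orderings\<close>

definition is_greatest :: "('p \<Rightarrow> 'p \<Rightarrow> bool) \<Rightarrow> 'p \<Rightarrow> 'p set \<Rightarrow> bool" where
  "is_greatest gt p A \<longleftrightarrow> p \<in> A \<and> (\<forall>p'\<in>A. p' \<noteq> p \<longrightarrow> gt p p')"

lemma greatest_mon_eq_Some:
  assumes "strict_total_on M gt" "A \<subseteq> M" "is_greatest gt p A"
  shows "greatest_mon gt A = Some p"
proof -
  have "(THE p. p \<in> A \<and> (\<forall>p'\<in>A. p' \<noteq> p \<longrightarrow> gt p p')) = p"
  proof (rule the_equality)
    fix p' assume p': "p' \<in> A \<and> (\<forall>p''\<in>A. p'' \<noteq> p' \<longrightarrow> gt p' p'')"
    show "p' = p"
    proof (rule ccontr)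
      assume "p' \<noteq> p"
      with p' assms(3) have "gt p p'" "gt p' p" "p \<in> M" "p' \<in> M"
        using assms(2) by (auto simp: is_greatest_def)
      with assms(1) show False
        unfolding strict_total_on_def by (meson irreflp_onD transp_onD)
    qed
  qed (use assms(3) in \<open>auto simp: is_greatest_def\<close>)
  with assms(3) show ?thesis
    by (auto simp: greatest_mon_def is_greatest_def)
qed

locale t_local_module_ordering =
  fixes m n :: nat
    and gt :: "mon \<times> 's::finite \<Rightarrow> mon \<times> 's \<Rightarrow> bool"
    and gt1 :: "mon \<Rightarrow> mon \<Rightarrow> bool"
  assumes module_ordering: "module_monomial_ordering m n gt"
    and induced: "induced_ordering m n gt gt1"
    and t_local: "t_local m gt1"
begin

lemma strict_total_gt: "strict_total_on (Mon_mod m n) gt"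
  using module_ordering by (simp add: module_monomial_ordering_def)

lemma strict_total_gt1: "strict_total_on (Mon m n) gt1"
  using induced by (simp add: induced_ordering_def monomial_ordering_def)

lemma gt_irrefl: "p \<in> Mon_mod m n \<Longrightarrow> \<not> gt p p"
  using strict_total_gt by (simp add: strict_total_on_def irreflp_on_def)

lemma gt_trans:
  "gt p p' \<Longrightarrow> gt p' p'' \<Longrightarrow> p \<in> Mon_mod m n \<Longrightarrow> p' \<in> Mon_mod m n \<Longrightarrow> p'' \<in> Mon_mod m n \<Longrightarrow> gt p p''"
  using strict_total_gt unfolding strict_total_on_def by (meson transp_onD)

lemma gt_total: "p \<in> Mon_mod m n \<Longrightarrow> p' \<in> Mon_mod m n \<Longrightarrow> p = p' \<or> gt p p' \<or> gt p' p"
  using strict_total_gt by (auto simp: strict_total_on_def totalp_on_def)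

lemma gt1_irrefl: "c \<in> Mon m n \<Longrightarrow> \<not> gt1 c c"
  using strict_total_gt1 by (simp add: strict_total_on_def irreflp_on_def)

lemma gt1_trans:
  "gt1 c c' \<Longrightarrow> gt1 c' c'' \<Longrightarrow> c \<in> Mon m n \<Longrightarrow> c' \<in> Mon m n \<Longrightarrow> c'' \<in> Mon m n \<Longrightarrow> gt1 c c''"
  using strict_total_gt1 unfolding strict_total_on_def by (meson transp_onD)

lemma gt1_total: "c \<in> Mon m n \<Longrightarrow> c' \<in> Mon m n \<Longrightarrow> c = c' \<or> gt1 c c' \<or> gt1 c' c"
  using strict_total_gt1 by (auto simp: strict_total_on_def totalp_on_def)

lemma gt1_add_left:
  "gt1 c c' \<Longrightarrow> a \<in> Mon m n \<Longrightarrow> c \<in> Mon m n \<Longrightarrow> c' \<in> Mon m n \<Longrightarrow> gt1 (a + c) (a + c')"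
  using induced by (simp add: induced_ordering_def monomial_ordering_def)

lemma gt1_iff_gt: "c \<in> Mon m n \<Longrightarrow> c' \<in> Mon m n \<Longrightarrow> gt1 c c' \<longleftrightarrow> gt (c, i) (c', i)"
  using induced by (simp add: induced_ordering_def)

lemma gt_mult_mono:
  "gt p p' \<Longrightarrow> c \<in> Mon m n \<Longrightarrow> p \<in> Mon_mod m n \<Longrightarrow> p' \<in> Mon_mod m n \<Longrightarrow>
    gt (mon_mult c p) (mon_mult c p')"
  using module_ordering by (simp add: module_monomial_ordering_def)

lemma gt_mult_small:
  assumes "gt1 0 c" "c \<in> Mon m n" "p \<in> Mon_mod m n"
  shows "gt p (mon_mult c p)"
proof -
  have p: "fst p \<in> Mon m n"
    using assms(3) by (auto simp: Mon_mod_def)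
  have "gt1 (fst p + 0) (fst p + c)"
    using assms p by (intro gt1_add_left) auto
  then show ?thesis
    using p assms(2) gt1_iff_gt[of "fst p" "c + fst p" "snd p"]
    by (simp add: mon_mult_def Mon_add add.commute)
qed

text \<open>This gives multipliers smaller than \<open>1\<close> whenever a multiple of a leading monomial lies strictly
  below that leading monomial.\<close>

lemma gt_multD_small:
  assumes "gt p (mon_mult c p)" "c \<in> Mon m n" "p \<in> Mon_mod m n"
  shows "gt1 0 c"
proof (rule ccontr)
  assume "\<not> gt1 0 c"
  then consider "c = 0" | "gt1 c 0"
    using gt1_total[of 0 c] assms(2) by auto
  then show False
  proof cases
    case 2
    have p: "fst p \<in> Mon m n"
      using assms(3) by (auto simp: Mon_mod_def)
    have "gt1 (fst p + c) (fst p + 0)"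
      using 2 assms p by (intro gt1_add_left) auto
    then have "gt (mon_mult c p) p"
      using p assms(2) gt1_iff_gt[of "c + fst p" "fst p" "snd p"]
      by (simp add: mon_mult_def Mon_add add.commute)
    then show False
      using assms gt_trans gt_irrefl mon_mult_mem by blast
  qed (use assms gt_irrefl in simp)
qed

text \<open>A nontrivial \<open>t\<^sup>\<alpha>\<close> is a product of variables, each of which is smaller than \<open>1\<close>.\<close>

lemma t_monomial_small:
  assumes "\<alpha> \<in> expos m" "\<alpha> \<noteq> 0"
  shows "gt1 0 (\<alpha>, 0)"
  using assms
proof (induction "xdeg m \<alpha>" arbitrary: \<alpha> rule: less_induct)
  case less
  obtain i where i: "i \<in> Poly_Mapping.keys \<alpha>"
    using less.prems(2) by fastforce
  then have "i < m"
    using less.prems(1) by (auto simp: expos_def)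
  let ?e = "Poly_Mapping.single i (1::nat)"
  have e: "?e \<in> expos m" "?e \<noteq> 0" "gt1 0 (?e, 0)"
    using t_local \<open>i < m\<close> lookup_single_eq[of i "1::nat"]
    by (auto simp: expos_def t_local_def simp del: lookup_single_eq)
  have \<alpha>: "\<alpha> - ?e + ?e = \<alpha>"
    using i by (intro expo_diff_add[OF e(1)]) (auto simp: lookup_single in_keys_iff when_def)
  show ?case
  proof (cases "\<alpha> - ?e = 0")
    case True
    with \<alpha> e(3) show ?thesis by simp
  next
    case False
    have "xdeg m (\<alpha> - ?e) < xdeg m \<alpha>"
      using arg_cong[OF \<alpha>, of "xdeg m"] xdeg_pos[OF e(1,2)] by simp
    then have gt: "gt1 0 (\<alpha> - ?e, 0)"
      using less.prems(1) False by (intro less.hyps) (auto intro: expos_diff)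
    have mon: "(\<alpha> - ?e, 0) \<in> Mon m n" "(?e, 0) \<in> Mon m n" "(\<alpha>, 0) \<in> Mon m n"
      using less.prems(1) e(1) by (auto simp: Mon_def intro: expos_diff)
    have "gt1 (\<alpha> - ?e, 0) (\<alpha>, 0)"
      using gt1_add_left[OF e(3) mon(1) zero_Mon mon(2)] \<alpha> by simp
    with gt show ?thesis
      by (rule gt1_trans) (use mon in auto)
  qed
qed

definition bounded_mons :: "nat \<Rightarrow> (mon \<times> 's) set" where
  "bounded_mons d = {p \<in> Mon_mod m n. xdeg n (snd (fst p)) \<le> d}"

lemma bounded_monsD: "p \<in> bounded_mons d \<Longrightarrow> p \<in> Mon_mod m n"
  by (simp add: bounded_mons_def)

text \<open>In an infinite ascending chain of monomials of bounded \<open>x\<close>-degree, infinitely many share the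
  unit vector and the exponent of \<open>x\<close>, because there are only finitely many of these. Among them
  one divides a later one with quotient \<open>t\<^sup>\<alpha>\<close>, and is thus not smaller than it.\<close>

lemma wf_bounded_mons: "wf {(p', p). p' \<in> bounded_mons d \<and> p \<in> bounded_mons d \<and> gt p' p}"
proof (rule ccontr)
  assume "\<not> ?thesis"
  then obtain p where p: "\<And>i. p i \<in> bounded_mons d" "\<And>i. gt (p (Suc i)) (p i)"
    unfolding wf_iff_no_infinite_down_chain by auto
  have mon: "p i \<in> Mon_mod m n" for i
    using p(1) bounded_monsD by blast
  have less: "gt (p j) (p i)" if "i < j" for i j
    using that by (induction rule: less_Suc_induct) (use p(2) mon gt_trans in blast)+
  have "(\<lambda>i. (snd (fst (p i)), snd (p i))) ` UNIV \<subseteq> {\<beta> \<in> expos n. xdeg n \<beta> \<le> d} \<times> UNIV"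
    using p(1) by (auto simp: bounded_mons_def Mon_mod_def Mon_def mem_Times_iff)
  then have "finite (range (\<lambda>i. (snd (fst (p i)), snd (p i))))"
    by (rule finite_subset) (simp add: finite_xdeg_le)
  then obtain i j where ij: "i < j" "snd (fst (p i)) = snd (fst (p j))" "snd (p i) = snd (p j)"
    "\<And>l. l < m \<Longrightarrow> Poly_Mapping.lookup (fst (fst (p i))) l \<le> Poly_Mapping.lookup (fst (fst (p j))) l"
    by (rule Dickson_sequence[of "{..<m}" "\<lambda>i. (snd (fst (p i)), snd (p i))"
        "\<lambda>l i. Poly_Mapping.lookup (fst (fst (p i))) l", rotated]) auto
  let ?\<alpha> = "fst (fst (p j)) - fst (fst (p i))"
  have expos: "fst (fst (p i)) \<in> expos m" "?\<alpha> \<in> expos m"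
    using mon[of i] mon[of j] by (auto simp: Mon_mod_def Mon_def intro: expos_diff)
  then have eq: "p j = mon_mult (?\<alpha>, 0) (p i)"
    using expo_diff_add[OF expos(1) ij(4)] ij(2,3)
    by (auto simp: mon_mult_def prod_eq_iff)
  show False
  proof (cases "?\<alpha> = 0")
    case True
    with eq have "p j = p i"
      by (simp flip: zero_prod_def)
    with less[OF ij(1)] mon gt_irrefl show False by metis
  next
    case False
    then have "gt (p i) (mon_mult (?\<alpha>, 0) (p i))"
      using expos t_monomial_small mon by (intro gt_mult_small) (auto simp: Mon_def)
    then have "gt (p i) (p j)"
      by (simp flip: eq)
    with less[OF ij(1)] mon show False
      using gt_trans gt_irrefl by blast
  qed
qed

lemma ex_greatest:
  assumes "A \<subseteq> bounded_mons d" "A \<noteq> {}"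
  shows "\<exists>p. is_greatest gt p A"
proof -
  obtain p where p: "p \<in> A" "\<And>p'. p' \<in> bounded_mons d \<Longrightarrow> gt p' p \<Longrightarrow> p' \<notin> A"
    using wf_bounded_mons[of d, unfolded wf_eq_minimal] assms
    by (smt (verit) all_not_in_conv case_prodI mem_Collect_eq subsetD)
  have "gt p p'" if "p' \<in> A" "p' \<noteq> p" for p'
    using p that assms(1) gt_total[of p p'] bounded_monsD by blast
  with p(1) have "is_greatest gt p A"
    by (simp add: is_greatest_def)
  then show ?thesis ..
qed

lemma ex_bounded_mons:
  assumes "h \<in> psp_module m n"
  obtains d where "mod_supp h \<subseteq> bounded_mons d"
proof -
  let ?B = "xdeg n ` (\<Union>i. Poly_Mapping.keys (h $ i))"
  have fin: "finite ?B"
    by simp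
  have "mod_supp h \<subseteq> bounded_mons (Max ?B)"
  proof
    fix p assume p: "p \<in> mod_supp h"
    then have "snd (fst p) \<in> Poly_Mapping.keys (h $ snd p)"
      by (auto simp: mod_supp_iff psp_coeff_def in_keys_iff zero_mfps.rep_eq)
    then have "xdeg n (snd (fst p)) \<le> Max ?B"
      using fin by (intro Max_ge) auto
    with p assms show "p \<in> bounded_mons (Max ?B)"
      by (auto simp: bounded_mons_def psp_module_iff)
  qed
  then show thesis by (rule that)
qed


section \<open>Division with bounded degree in the polynomial variables\<close>

text \<open>A monomial \<open>p\<close> is reducible by \<open>(j, c)\<close> if \<open>p = c lm(h\<^sub>j)\<close> and the degree bound
  \<open>xdeg n (snd c) + D j\<close> of \<open>c h\<^sub>j\<close> does not exceed \<open>d\<close>. Fix one such pair for every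
  reducible \<open>p\<close>. The quantity \<open>\<rho> p\<close> is what is left at \<open>p\<close> when all larger monomials have been
  dealt with; it is cancelled by the multiple \<open>\<rho> p / lc(h\<^sub>j) \<cdot> c h\<^sub>j\<close> if \<open>p\<close> is reducible, and is
  the coefficient of the remainder otherwise. Since cancelling at \<open>p'\<close> affects only smaller
  monomials, \<open>\<rho>\<close> is defined by recursion along the ordering, which is well-founded because all
  monomials have degree at most \<open>d\<close>. Each recursion step needs only finitely many earlier values,
  since \<open>p\<close> has finitely many divisors \<open>c\<close>.\<close>

lemma determinate_division:
  fixes h :: "'j \<Rightarrow> 'k::field psp ^ 's" and v :: "'k psp ^ 's"
  assumes J: "finite J"
    and h: "\<And>j. j \<in> J \<Longrightarrow> mod_supp (h j) \<subseteq> bounded_mons (D j)"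
    and P: "\<And>j. j \<in> J \<Longrightarrow> is_greatest gt (P j) (mod_supp (h j))"
    and v: "mod_supp v \<subseteq> bounded_mons d"
  obtains q :: "'j \<Rightarrow> 'k psp" where
    "\<And>j c. j \<in> J \<Longrightarrow> c \<in> psp_supp (q j) \<Longrightarrow>
      c \<in> Mon m n \<and> (\<exists>p\<in>mod_supp v. p = mon_mult c (P j) \<or> gt p (mon_mult c (P j)))"
    "\<And>p. p \<in> mod_supp (v - (\<Sum>j\<in>J. q j *s h j)) \<Longrightarrow>
      p \<in> bounded_mons d \<and> (\<exists>p'\<in>mod_supp v. p' = p \<or> gt p' p) \<and>
      (\<forall>j\<in>J. \<forall>c\<in>Mon m n. p = mon_mult c (P j) \<longrightarrow> d < xdeg n (snd c) + D j)"
proof -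
  define red where "red p x \<longleftrightarrow>
      (case x of (j, c) \<Rightarrow> j \<in> J \<and> c \<in> Mon m n \<and> p = mon_mult c (P j) \<and> xdeg n (snd c) + D j \<le> d)"
    for p and x :: "'j \<times> mon"
  \<comment> \<open>The multiplier \<open>c\<close> of \<open>h j\<close> is the one chosen for cancelling at the monomial \<open>c lm(h\<^sub>j)\<close>.\<close>
  define act where "act x \<longleftrightarrow> (case x of (j, c) \<Rightarrow>
      red (mon_mult c (P j)) (j, c) \<and> (SOME y. red (mon_mult c (P j)) y) = (j, c))"
    for x :: "'j \<times> mon"
  define R where "R = {(p', p). p' \<in> bounded_mons d \<and> p \<in> bounded_mons d \<and> gt p' p}"
  define quot where "quot \<rho> j c = (if act (j, c) then \<rho> (mon_mult c (P j)) / mod_coeff (h j) (P j) else 0)"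
    for \<rho> :: "mon \<times> 's \<Rightarrow> 'k" and j c
  define I where "I p = J \<times> mon_splits (fst p)" for p :: "mon \<times> 's"
  \<comment> \<open>The guard on \<open>R\<close> restricts the sum to multiples whose leading monomial is larger than \<open>p\<close>, so
    that the recursive calls are well-founded.\<close>
  define F where "F \<rho> p = mod_coeff v p - (\<Sum>(j, c, c')\<in>I p.
      if (mon_mult c (P j), p) \<in> R then quot \<rho> j c * mod_coeff (h j) (c', snd p) else 0)" for \<rho> p
  define \<rho> where "\<rho> = wfrec R F"
  have wf: "wf R"
    unfolding R_def by (rule wf_bounded_mons)
  have "\<rho> p = F (cut \<rho> R p) p" for p
    unfolding \<rho>_def by (rule wfrec[OF wf])
  also have "F (cut \<rho> R p) p = F \<rho> p" for p
    unfolding F_def quot_def by (intro arg_cong2[where f = minus] sum.cong refl) (auto simp: cut_apply)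
  finally have \<rho>: "\<rho> p = F \<rho> p" for p .

  have finI: "finite (I p)" for p
    by (simp add: I_def J finite_mon_splits)
  have PD: "P j \<in> mod_supp (h j)" "P j \<in> bounded_mons (D j)" "P j \<in> Mon_mod m n"
      "mod_coeff (h j) (P j) \<noteq> 0" if "j \<in> J" for j
    using P[OF that] h[OF that] bounded_monsD[of "P j"] by (auto simp: is_greatest_def mod_supp_iff)
  have actD: "j \<in> J" "c \<in> Mon m n" "xdeg n (snd c) + D j \<le> d" "mon_mult c (P j) \<in> bounded_mons d"
    if "act (j, c)" for j c
  proof -
    show *: "j \<in> J" "c \<in> Mon m n" "xdeg n (snd c) + D j \<le> d"
      using that by (auto simp: act_def red_def)
    show "mon_mult c (P j) \<in> bounded_mons d"
      using PD[OF *(1)] *(2,3) by (auto simp: bounded_mons_def mon_mult_mem) (simp add: mon_mult_def)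
  qed
  \<comment> \<open>A multiple \<open>c h\<^sub>j\<close> that is used contributes only at its leading monomial and at smaller
    ones, and never leaves the degree bound.\<close>
  have step: "p \<in> bounded_mons d \<and> (mon_mult c (P j) = p \<or> (mon_mult c (P j), p) \<in> R)"
    if "act (j, c)" "c + c' = fst p" "mod_coeff (h j) (c', snd p) \<noteq> 0" for j c c' p
  proof -
    note * = actD[OF that(1)]
    have c': "(c', snd p) \<in> mod_supp (h j)"
      using that(3) by (simp add: mod_supp_iff)
    have p: "p = mon_mult c (c', snd p)"
      using that(2) by (simp add: mon_mult_def prod_eq_iff)
    have "(c', snd p) \<in> bounded_mons (D j)"
      using c' h *(1) by auto
    moreover from this have "(c', snd p) \<in> Mon_mod m n"
      by (rule bounded_monsD)
    moreover have "xdeg n (snd (fst p)) = xdeg n (snd c) + xdeg n (snd c')"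
      by (subst p) (simp add: mon_mult_def)
    ultimately have "p \<in> bounded_mons d"
      using *(2,3) mon_mult_mem[of c m n "(c', snd p)"] p by (auto simp: bounded_mons_def)
    moreover have "(c', snd p) = P j \<or> gt (P j) (c', snd p)"
      using P[OF *(1)] c' by (auto simp: is_greatest_def)
    then have "mon_mult c (P j) = p \<or> gt (mon_mult c (P j)) p"
      using gt_mult_mono[OF _ *(2) PD(3)[OF *(1)] \<open>(c', snd p) \<in> Mon_mod m n\<close>] p by auto
    ultimately show ?thesis
      using *(4) by (auto simp: R_def)
  qed

  have \<rho>_supp: "p \<in> bounded_mons d \<and> (\<exists>p'\<in>mod_supp v. p' = p \<or> gt p' p)" if "\<rho> p \<noteq> 0" for p
    using wf that
  proof (induction p rule: wf_induct_rule)
    case (less p)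
    show ?case
    proof (cases "p \<in> mod_supp v")
      case False
      then have "(\<Sum>(j, c, c')\<in>I p.
          if (mon_mult c (P j), p) \<in> R then quot \<rho> j c * mod_coeff (h j) (c', snd p) else 0) \<noteq> 0"
        using less.prems \<rho>[of p] by (simp add: F_def mod_supp_iff)
      then obtain x where "(case x of (j, c, c') \<Rightarrow>
          if (mon_mult c (P j), p) \<in> R then quot \<rho> j c * mod_coeff (h j) (c', snd p) else 0) \<noteq> 0"
        by (rule sum.not_neutral_contains_not_neutral)
      then obtain j c where jc: "(mon_mult c (P j), p) \<in> R" "\<rho> (mon_mult c (P j)) \<noteq> 0"
        by (auto simp: quot_def split: if_splits prod.splits)
      then obtain p' where p': "p' \<in> mod_supp v" "p' = mon_mult c (P j) \<or> gt p' (mon_mult c (P j))"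
        using less.IH by blast
      have "gt (mon_mult c (P j)) p" "p \<in> bounded_mons d" "mon_mult c (P j) \<in> bounded_mons d"
        using jc(1) by (auto simp: R_def)
      with p' v show ?thesis
        using gt_trans[of p' "mon_mult c (P j)" p] bounded_monsD by blast
    qed (use v in auto)
  qed

  define q where "q j = psp_of (quot \<rho> j)" for j
  have q: "psp_coeff (q j) c = quot \<rho> j c" for j c
    unfolding q_def
  proof (rule psp_coeff_psp_of[OF finite_xdeg_le[of n d]])
    fix c assume "quot \<rho> j c \<noteq> 0"
    then have "act (j, c)"
      by (auto simp: quot_def split: if_splits)
    from actD[OF this] show "snd c \<in> {\<beta> \<in> expos n. xdeg n \<beta> \<le> d}"
      by (auto simp: Mon_def)
  qed

  \<comment> \<open>At a reducible \<open>p\<close> exactly one multiple has leading monomial \<open>p\<close>, namely the chosen one.\<close>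
  have lead: "(\<Sum>(j, c, c')\<in>I p.
      if mon_mult c (P j) = p then quot \<rho> j c * mod_coeff (h j) (c', snd p) else 0) =
      (if \<exists>x. red p x then \<rho> p else 0)" (is "(\<Sum>x\<in>I p. ?t x) = _") for p
  proof -
    have sel: "(SOME y. red p y) = (j, c) \<and> red p (j, c) \<and> c' = fst (P j)"
      if "(j, c, c') \<in> I p" "?t (j, c, c') \<noteq> 0" for j c c'
    proof -
      have "mon_mult c (P j) = p" "act (j, c)"
        using that by (auto simp: quot_def split: if_splits)
      with that(1) show ?thesis
        by (auto simp: act_def I_def mon_splits_def mon_mult_def)
    qed
    show ?thesis
    proof (cases "\<exists>x. red p x")
      case True
      obtain j c where jc: "(SOME y. red p y) = (j, c)"
        by (cases "SOME y. red p y")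
      with True have red: "red p (j, c)"
        by (metis someI_ex)
      then have p: "j \<in> J" "mon_mult c (P j) = p"
        by (auto simp: red_def)
      have "(j, c, fst (P j)) \<in> I p"
        using p by (auto simp: I_def mon_splits_def mon_mult_def)
      moreover have "?t x = 0" if "x \<in> I p" "x \<noteq> (j, c, fst (P j))" for x
      proof (rule ccontr)
        obtain j' c1 c1' where x: "x = (j', c1, c1')"
          by (cases x)
        assume "?t x \<noteq> 0"
        then have "?t (j', c1, c1') \<noteq> 0" "(j', c1, c1') \<in> I p"
          using that(1) unfolding x by -
        then have *: "(SOME y. red p y) = (j', c1) \<and> red p (j', c1) \<and> c1' = fst (P j')"
          by (intro sel)
        with jc have "(j', c1) = (j, c)"
          by metis
        with * that(2) show False
          unfolding x by blast
      qed
      ultimately have "(\<Sum>x\<in>I p. ?t x) = (\<Sum>x\<in>{(j, c, fst (P j))}. ?t x)"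
        using finI by (intro sum.mono_neutral_right) blast+
      also have "\<dots> = \<rho> p"
        using p PD(4)[OF p(1)] red jc by (auto simp: quot_def act_def mon_mult_def)
      finally show ?thesis
        using True by simp
    next
      case False
      with sel have "?t x = 0" if "x \<in> I p" for x
        using that by (cases x) blast
      with False show ?thesis
        by simp
    qed
  qed
  have coeff: "mod_coeff (v - (\<Sum>j\<in>J. q j *s h j)) p = (if \<exists>x. red p x then 0 else \<rho> p)" for p
  proof -
    have "mod_coeff (\<Sum>j\<in>J. q j *s h j) p = (\<Sum>j\<in>J. mod_coeff (q j *s h j) p)"
      by simp
    also have "\<dots> = (\<Sum>(j, c, c')\<in>I p. quot \<rho> j c * mod_coeff (h j) (c', snd p))"
      unfolding mod_coeff_smult I_def
      by (subst sum.cartesian_product[symmetric]) (simp add: q case_prod_beta)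
    also have "\<dots> = (\<Sum>(j, c, c')\<in>I p.
        (if (mon_mult c (P j), p) \<in> R then quot \<rho> j c * mod_coeff (h j) (c', snd p) else 0) +
        (if mon_mult c (P j) = p then quot \<rho> j c * mod_coeff (h j) (c', snd p) else 0))"
    proof (intro sum.cong refl, clarify)
      fix j c c' assume "(j, c, c') \<in> I p"
      then have "c + c' = fst p"
        by (simp add: I_def mon_splits_def)
      have "(p, p) \<notin> R"
        using gt_irrefl bounded_monsD by (auto simp: R_def)
      with step[OF _ \<open>c + c' = fst p\<close>, of j] show "quot \<rho> j c * mod_coeff (h j) (c', snd p) =
        (if (mon_mult c (P j), p) \<in> R then quot \<rho> j c * mod_coeff (h j) (c', snd p) else 0) +
        (if mon_mult c (P j) = p then quot \<rho> j c * mod_coeff (h j) (c', snd p) else 0)"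
        by (cases "act (j, c)"; cases "mod_coeff (h j) (c', snd p) = 0") (auto simp: quot_def)
    qed
    also have "\<dots> = mod_coeff v p - \<rho> p + (if \<exists>x. red p x then \<rho> p else 0)"
      using \<rho>[of p] lead[of p] by (simp add: F_def case_prod_beta sum.distrib)
    finally show ?thesis
      by simp
  qed

  show thesis
  proof (rule that)
    fix j c assume "j \<in> J" "c \<in> psp_supp (q j)"
    then have "act (j, c)" "\<rho> (mon_mult c (P j)) \<noteq> 0"
      by (auto simp: psp_supp_def q quot_def split: if_splits)
    then show "c \<in> Mon m n \<and> (\<exists>p\<in>mod_supp v. p = mon_mult c (P j) \<or> gt p (mon_mult c (P j)))"
      using actD(2) \<rho>_supp by blast
  next
    fix p assume "p \<in> mod_supp (v - (\<Sum>j\<in>J. q j *s h j))"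
    then have "\<not> (\<exists>x. red p x)" "\<rho> p \<noteq> 0"
      unfolding mod_supp_iff coeff by (auto split: if_splits)
    with \<rho>_supp[of p] show "p \<in> bounded_mons d \<and> (\<exists>p'\<in>mod_supp v. p' = p \<or> gt p' p) \<and>
      (\<forall>j\<in>J. \<forall>c\<in>Mon m n. p = mon_mult c (P j) \<longrightarrow> d < xdeg n (snd c) + D j)"
      by (auto simp: red_def not_le)
  qed
qed

end


section \<open>Weak division with remainder\<close>

locale weak_division_setup = t_local_module_ordering m n gt gt1
  for m n :: nat
    and gt :: "mon \<times> 's::finite \<Rightarrow> mon \<times> 's \<Rightarrow> bool"
    and gt1 :: "mon \<Rightarrow> mon \<Rightarrow> bool" +
  fixes k :: nat and g :: "nat \<Rightarrow> 'k::field psp ^ 's" and f :: "'k psp ^ 's"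
  assumes g: "\<And>j. j < k \<Longrightarrow> g j \<in> psp_module m n"
    and f: "f \<in> psp_module m n"
begin

text \<open>Comparing with some monomial of \<open>f\<close> expresses \<open>p \<le> lm(f)\<close> uniformly: for \<open>f = 0\<close> no
  monomial qualifies. Bounding all monomials of the \<open>q\<^sub>j g\<^sub>j\<close> in this way, instead of their leading
  monomials, makes the bound stable under sums and products.\<close>

definition below_f :: "mon \<times> 's \<Rightarrow> bool" where
  "below_f p \<longleftrightarrow> p \<in> Mon_mod m n \<and> (\<exists>p'\<in>mod_supp f. p' = p \<or> gt p' p)"

text \<open>The elements \<open>1 + b\<close> with \<open>b\<close> in this set are exactly those of leading term \<open>1\<close>; working with
  \<open>b\<close> instead turns the multiplicative set into an additive group closed under products.\<close>

definition below_one :: "'k psp set" where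
  "below_one = {b. \<forall>c\<in>psp_supp b. c \<in> Mon m n \<and> gt1 0 c}"

definition low_combos :: "('k psp ^ 's) set" where
  "low_combos = {\<Sum>j<k. q j *s g j |q.
     \<forall>j<k. q j \<in> psp_ring m n \<and> (\<forall>p\<in>mod_supp (q j *s g j). below_f p)}"

definition partial_rems :: "('k psp ^ 's) set" where
  "partial_rems = {r \<in> psp_module m n. \<exists>b\<in>below_one. f + b *s f - r \<in> low_combos}"

lemma f_mon: "p \<in> mod_supp f \<Longrightarrow> p \<in> Mon_mod m n"
  using f by (auto simp: psp_module_iff)

lemma below_f_self: "p \<in> mod_supp f \<Longrightarrow> below_f p"
  using f_mon by (auto simp: below_f_def)

lemma below_f_trans: "below_f p \<Longrightarrow> p' \<in> Mon_mod m n \<Longrightarrow> p' = p \<or> gt p p' \<Longrightarrow> below_f p'"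
  unfolding below_f_def using gt_trans f_mon by blast

lemma below_f_small: "below_f p \<Longrightarrow> c \<in> Mon m n \<Longrightarrow> gt1 0 c \<Longrightarrow> below_f (mon_mult c p)"
  by (rule below_f_trans) (auto simp: below_f_def intro: gt_mult_small mon_mult_mem)

lemma below_one_zero: "0 \<in> below_one"
  by (simp add: below_one_def psp_supp_def)

lemma below_one_diff: "b \<in> below_one \<Longrightarrow> b' \<in> below_one \<Longrightarrow> b - b' \<in> below_one"
  unfolding below_one_def psp_supp_def by (auto; metis diff_self)

lemma below_one_mult:
  assumes "b \<in> below_one" "b' \<in> below_one"
  shows "b * b' \<in> below_one"
  unfolding below_one_def
proof clarify
  fix p :: mon assume "p \<in> psp_supp (b * b')"
  then obtain c c' where c: "c \<in> psp_supp b" "c' \<in> psp_supp b'" "p = c + c'"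
    by (rule psp_supp_mult)
  with assms have mon: "c \<in> Mon m n" "gt1 0 c" "c' \<in> Mon m n" "gt1 0 c'"
    by (auto simp: below_one_def)
  have "gt1 (c + 0) (c + c')"
    using mon by (intro gt1_add_left) auto
  with mon show "p \<in> Mon m n \<and> gt1 0 p"
    using gt1_trans[of 0 c "c + c'"] by (simp add: c(3) Mon_add)
qed

lemma below_one_ring: "b \<in> below_one \<Longrightarrow> b \<in> psp_ring m n"
  by (auto simp: below_one_def psp_ring_iff)

lemma low_combosI:
  assumes "\<And>j. j < k \<Longrightarrow> q j \<in> psp_ring m n"
    and "\<And>j p. j < k \<Longrightarrow> p \<in> mod_supp (q j *s g j) \<Longrightarrow> below_f p"
  shows "(\<Sum>j<k. q j *s g j) \<in> low_combos"
  unfolding low_combos_def using assms by blast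

lemma low_combos_zero: "0 \<in> low_combos"
  using low_combosI[of "\<lambda>_. 0"] by (simp add: psp_ring_zero)

lemma low_combos_add:
  assumes "w \<in> low_combos" "w' \<in> low_combos"
  shows "w + w' \<in> low_combos"
proof -
  obtain q where q: "w = (\<Sum>j<k. q j *s g j)"
      "\<And>j. j < k \<Longrightarrow> q j \<in> psp_ring m n" "\<And>j p. j < k \<Longrightarrow> p \<in> mod_supp (q j *s g j) \<Longrightarrow> below_f p"
    using assms(1) unfolding low_combos_def by blast
  obtain q' where q': "w' = (\<Sum>j<k. q' j *s g j)"
      "\<And>j. j < k \<Longrightarrow> q' j \<in> psp_ring m n" "\<And>j p. j < k \<Longrightarrow> p \<in> mod_supp (q' j *s g j) \<Longrightarrow> below_f p"
    using assms(2) unfolding low_combos_def by blast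
  have "(\<Sum>j<k. (q j + q' j) *s g j) \<in> low_combos"
  proof (rule low_combosI)
    fix j p assume "j < k" "p \<in> mod_supp ((q j + q' j) *s g j)"
    then show "below_f p"
      using mod_supp_add[of "q j *s g j" "q' j *s g j"] q(3) q'(3)
      unfolding vector_sadd_rdistrib by blast
  qed (use q(2) q'(2) psp_ring_add in blast)
  then show ?thesis
    by (simp add: q(1) q'(1) vector_sadd_rdistrib sum.distrib)
qed

lemma low_combos_uminus:
  assumes "w \<in> low_combos"
  shows "- w \<in> low_combos"
proof -
  obtain q where q: "w = (\<Sum>j<k. q j *s g j)"
      "\<And>j. j < k \<Longrightarrow> q j \<in> psp_ring m n" "\<And>j p. j < k \<Longrightarrow> p \<in> mod_supp (q j *s g j) \<Longrightarrow> below_f p"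
    using assms unfolding low_combos_def by blast
  have "(\<Sum>j<k. (- q j) *s g j) \<in> low_combos"
  proof (rule low_combosI)
    fix j p assume "j < k" "p \<in> mod_supp ((- q j) *s g j)"
    then show "below_f p"
      using q(3)[of j p] by (simp add: mod_supp_iff)
  qed (use q(2) psp_ring_uminus in blast)
  also have "(\<Sum>j<k. (- q j) *s g j) = - w"
    by (simp add: q(1) vec_eq_iff sum_negf)
  finally show ?thesis .
qed

lemma low_combos_below_one:
  assumes "b \<in> below_one" "w \<in> low_combos"
  shows "b *s w \<in> low_combos"
proof -
  obtain q where q: "w = (\<Sum>j<k. q j *s g j)"
      "\<And>j. j < k \<Longrightarrow> q j \<in> psp_ring m n" "\<And>j p. j < k \<Longrightarrow> p \<in> mod_supp (q j *s g j) \<Longrightarrow> below_f p"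
    using assms(2) unfolding low_combos_def by blast
  have "(\<Sum>j<k. (b * q j) *s g j) \<in> low_combos"
  proof (rule low_combosI)
    fix j p assume j: "j < k" and "p \<in> mod_supp ((b * q j) *s g j)"
    then have "p \<in> mod_supp (b *s (q j *s g j))"
      unfolding vector_smult_assoc by -
    then obtain c p' where "c \<in> psp_supp b" "p' \<in> mod_supp (q j *s g j)" "p = mon_mult c p'"
      by (rule mod_supp_smult)
    with assms(1) q(3)[OF j] show "below_f p"
      unfolding below_one_def using below_f_small by blast
  qed (use q(2) psp_ring_mult below_one_ring[OF assms(1)] in blast)
  also have "(\<Sum>j<k. (b * q j) *s g j) = b *s w"
    by (simp add: q(1) vec_eq_iff sum_distrib_left mult.assoc)
  finally show ?thesis .
qed

lemma low_combos_single:
  assumes "j < k" "a \<in> psp_ring m n" "\<And>p. p \<in> mod_supp (a *s g j) \<Longrightarrow> below_f p"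
  shows "a *s g j \<in> low_combos"
proof -
  have "(\<Sum>i<k. (if i = j then a else 0) *s g i) \<in> low_combos"
    by (rule low_combosI) (use assms psp_ring_zero in \<open>auto split: if_splits\<close>)
  also have "(\<Sum>i<k. (if i = j then a else 0) *s g i) = a *s g j"
    using assms(1) by (subst sum.remove[of _ j]) auto
  finally show ?thesis .
qed

lemma low_combos_below:
  assumes "w \<in> low_combos" "p \<in> mod_supp w"
  shows "below_f p"
proof -
  obtain q where q: "w = (\<Sum>j<k. q j *s g j)"
      "\<And>j p. j < k \<Longrightarrow> p \<in> mod_supp (q j *s g j) \<Longrightarrow> below_f p"
    using assms(1) unfolding low_combos_def by blast
  have "(\<Sum>j<k. mod_coeff (q j *s g j) p) \<noteq> 0"
    using assms(2) by (simp add: mod_supp_iff q(1))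
  then obtain j where "j \<in> {..<k}" "mod_coeff (q j *s g j) p \<noteq> 0"
    by (rule sum.not_neutral_contains_not_neutral)
  with q(2) show ?thesis
    unfolding mod_supp_iff by blast
qed

lemma f_in_partial_rems: "f \<in> partial_rems"
  unfolding partial_rems_def using f below_one_zero low_combos_zero by (intro CollectI conjI bexI[of _ 0]) auto

lemma partial_rems_module: "r \<in> partial_rems \<Longrightarrow> r \<in> psp_module m n"
  by (simp add: partial_rems_def)

lemma partial_rems_below:
  assumes "r \<in> partial_rems" "p \<in> mod_supp r"
  shows "below_f p"
proof -
  obtain b where b: "b \<in> below_one" "f + b *s f - r \<in> low_combos"
    using assms(1) unfolding partial_rems_def by blast
  have "mod_supp r \<subseteq> mod_supp (f + b *s f) \<union> mod_supp (f + b *s f - r)"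
    using mod_supp_diff[of "f + b *s f" "f + b *s f - r"] by simp
  with assms(2) consider "p \<in> mod_supp f" | "p \<in> mod_supp (b *s f)" | "p \<in> mod_supp (f + b *s f - r)"
    using mod_supp_add[of f "b *s f"] by blast
  then show ?thesis
  proof cases
    case 2
    then obtain c p' where "c \<in> psp_supp b" "p' \<in> mod_supp f" "p = mon_mult c p'"
      by (rule mod_supp_smult)
    with b(1) below_f_self show ?thesis
      unfolding below_one_def using below_f_small by blast
  qed (use below_f_self low_combos_below b(2) in auto)
qed

lemma partial_rems_diff_low_combos:
  assumes "r \<in> partial_rems" "w \<in> low_combos" "w \<in> psp_module m n"
  shows "r - w \<in> partial_rems"
proof -
  obtain b where b: "b \<in> below_one" "f + b *s f - r \<in> low_combos"
    using assms(1) unfolding partial_rems_def by blast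
  have "f + b *s f - (r - w) = (f + b *s f - r) + w"
    by simp
  then have "f + b *s f - (r - w) \<in> low_combos"
    using low_combos_add[OF b(2) assms(2)] by metis
  with b(1) partial_rems_module[OF assms(1)] assms(3) psp_module_diff show ?thesis
    unfolding partial_rems_def by blast
qed

text \<open>If \<open>(1 + b\<^sub>1) f = w\<^sub>1 + r\<close> and \<open>(1 + b\<^sub>2) f = w\<^sub>2 + h\<close>, then
  \<open>(1 + b\<^sub>1 - b - b b\<^sub>2) f = (w\<^sub>1 - b w\<^sub>2) + (r - b h)\<close>. For this reason a partial remainder may
  be reduced by others, but only with multipliers smaller than \<open>1\<close>.\<close>

lemma partial_rems_diff_below_one:
  assumes "r \<in> partial_rems" "h \<in> partial_rems" "b \<in> below_one"
  shows "r - b *s h \<in> partial_rems"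
proof -
  obtain b1 where b1: "b1 \<in> below_one" "f + b1 *s f - r \<in> low_combos"
    using assms(1) unfolding partial_rems_def by blast
  obtain b2 where b2: "b2 \<in> below_one" "f + b2 *s f - h \<in> low_combos"
    using assms(2) unfolding partial_rems_def by blast
  let ?b = "(b1 - b) - b * b2"
  have "?b \<in> below_one"
    using b1 b2 assms(3) by (intro below_one_diff below_one_mult)
  moreover have "f + ?b *s f - (r - b *s h) = (f + b1 *s f - r) + - (b *s (f + b2 *s f - h))"
    by (simp add: vec_eq_iff algebra_simps)
  then have "f + ?b *s f - (r - b *s h) \<in> low_combos"
    using b1 b2 assms(3) low_combos_add low_combos_uminus low_combos_below_one by presburger
  moreover have "r - b *s h \<in> psp_module m n"
    using assms by (intro psp_module_diff psp_module_smult below_one_ring partial_rems_module)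
  ultimately show ?thesis
    unfolding partial_rems_def by blast
qed

lemma partial_rems_diff_sum_below_one:
  assumes "finite H" "\<And>x. x \<in> H \<Longrightarrow> h x \<in> partial_rems" "\<And>x. x \<in> H \<Longrightarrow> b x \<in> below_one" "r \<in> partial_rems"
  shows "r - (\<Sum>x\<in>H. b x *s h x) \<in> partial_rems"
  using assms
proof (induction H rule: finite_induct)
  case (insert x H)
  have "r - (\<Sum>x\<in>insert x H. b x *s h x) = (r - (\<Sum>x\<in>H. b x *s h x)) - b x *s h x"
    using insert.hyps by (simp add: algebra_simps)
  also have "\<dots> \<in> partial_rems"
    using insert by (intro partial_rems_diff_below_one) auto
  finally show ?case .
qed simp

lemma one_plus_below_one_in_S_gt: "b \<in> below_one \<Longrightarrow> 1 + b \<in> S_gt m n gt1"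
proof -
  assume b: "b \<in> below_one"
  have b0: "psp_coeff b 0 = 0"
    using b gt1_irrefl[OF zero_Mon] unfolding below_one_def psp_supp_def by blast
  have supp: "psp_supp (1 + b) = insert 0 (psp_supp b)"
    using b0 by (auto simp: psp_supp_def psp_coeff_one)
  have sub: "psp_supp (1 + b) \<subseteq> Mon m n"
    using b by (auto simp: supp below_one_def)
  have "is_greatest gt1 0 (psp_supp (1 + b))"
    using b by (auto simp: is_greatest_def supp below_one_def)
  then have "lm_ring gt1 (1 + b) = Some 0"
    unfolding lm_ring_def by (rule greatest_mon_eq_Some[OF strict_total_gt1 sub])
  moreover have "psp_term 1 0 = (1 :: 'k psp)"
    by (rule psp_eqI) (auto simp: psp_term_def psp_coeff_def psp_coeff_one[unfolded psp_coeff_def]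
        lookup_single Abs_mfps_inverse when_def zero_mfps.rep_eq prod_eq_iff)
  ultimately show ?thesis
    using sub b0 by (simp add: S_gt_def lt_ring_def psp_ring_iff psp_coeff_one)
qed

definition lmon :: "'k psp ^ 's \<Rightarrow> mon \<times> 's" where
  "lmon h = the (lm gt h)"

lemma lmon:
  assumes "h \<in> psp_module m n" "h \<noteq> 0"
  shows lm_eq_lmon: "lm gt h = Some (lmon h)" and lmon_greatest: "is_greatest gt (lmon h) (mod_supp h)"
proof -
  obtain d where "mod_supp h \<subseteq> bounded_mons d"
    using ex_bounded_mons assms(1) by blast
  then obtain p where p: "is_greatest gt p (mod_supp h)"
    using ex_greatest assms(2) mod_supp_eq_empty_iff by metis
  have "lm gt h = Some p"
    unfolding lm_def
    by (rule greatest_mon_eq_Some[OF strict_total_gt _ p]) (use assms in \<open>simp add: psp_module_iff\<close>)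
  with p show "lm gt h = Some (lmon h)" "is_greatest gt (lmon h) (mod_supp h)"
    by (simp_all add: lmon_def)
qed

text \<open>Division by the single element \<open>g\<^sub>j\<close> within a degree bound so large that the leading monomial
  of \<open>r\<close> is reducible; hence that monomial disappears and the remainder lies strictly below it.\<close>

lemma reduce_by_generator:
  assumes "r \<in> partial_rems" "mod_supp r \<subseteq> bounded_mons d" "is_greatest gt p (mod_supp r)"
    and "j < k" "is_greatest gt P (mod_supp (g j))" "c \<in> Mon m n" "p = mon_mult c P"
  obtains r' d' where "r' \<in> partial_rems" "mod_supp r' \<subseteq> bounded_mons d'" "\<And>p'. p' \<in> mod_supp r' \<Longrightarrow> gt p p'"
proof -
  obtain D where D: "mod_supp (g j) \<subseteq> bounded_mons D"
    using ex_bounded_mons g assms(4) by blast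
  \<comment> \<open>The second argument of the maximum is the degree bound of \<open>c g\<^sub>j\<close>.\<close>
  define d' where "d' = max d (xdeg n (snd c) + D)"
  have r: "mod_supp r \<subseteq> bounded_mons d'"
    using assms(2) by (force simp: bounded_mons_def d'_def)
  obtain q :: "unit \<Rightarrow> 'k psp" where
    q: "\<And>c. c \<in> psp_supp (q ()) \<Longrightarrow> c \<in> Mon m n \<and> (\<exists>p\<in>mod_supp r. p = mon_mult c P \<or> gt p (mon_mult c P))"
    and rem: "\<And>p. p \<in> mod_supp (r - q () *s g j) \<Longrightarrow>
      p \<in> bounded_mons d' \<and> (\<exists>p'\<in>mod_supp r. p' = p \<or> gt p' p) \<and>
      (\<forall>c\<in>Mon m n. p = mon_mult c P \<longrightarrow> d' < xdeg n (snd c) + D)"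
    by (rule determinate_division[of "{()}" "\<lambda>_. g j" "\<lambda>_. D" "\<lambda>_. P" r d']) (use D r assms(5) in auto)
  have ring: "q () \<in> psp_ring m n"
    using q by (auto simp: psp_ring_iff)
  have P: "P \<in> Mon_mod m n"
    using assms(5) D bounded_monsD unfolding is_greatest_def by blast
  have "below_f p'" if "p' \<in> mod_supp (q () *s g j)" for p'
  proof -
    obtain c' p'' where c': "c' \<in> psp_supp (q ())" "p'' \<in> mod_supp (g j)" "p' = mon_mult c' p''"
      using mod_supp_smult \<open>p' \<in> _\<close> by metis
    have mon: "c' \<in> Mon m n" "p'' \<in> Mon_mod m n"
      using q[OF c'(1)] c'(2) D bounded_monsD by blast+
    have "below_f (mon_mult c' P)"
      using q[OF c'(1)] partial_rems_below[OF assms(1)] below_f_trans mon_mult_mem[OF mon(1) P] by blast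
    moreover have "p'' = P \<or> gt P p''"
      using assms(5) c'(2) by (auto simp: is_greatest_def)
    ultimately show ?thesis
      unfolding c'(3) using mon P gt_mult_mono below_f_trans mon_mult_mem by metis
  qed
  then have "q () *s g j \<in> low_combos"
    using low_combos_single assms(4) ring by blast
  then have "r - q () *s g j \<in> partial_rems"
    using partial_rems_diff_low_combos assms(1,4) g ring psp_module_smult by blast
  moreover have "gt p p'" if p': "p' \<in> mod_supp (r - q () *s g j)" for p'
  proof -
    have "p' \<noteq> p"
      using rem[OF p'] assms(6,7) by (auto simp: d'_def)
    moreover obtain p'' where "p'' \<in> mod_supp r" "p'' = p' \<or> gt p'' p'"
      using rem[OF p'] by blast
    moreover have "p \<in> Mon_mod m n" "p' \<in> Mon_mod m n" "p'' \<in> Mon_mod m n"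
      using rem[OF p'] \<open>p'' \<in> mod_supp r\<close> r assms(3) bounded_monsD unfolding is_greatest_def by blast+
    ultimately show ?thesis
      using assms(3) gt_trans[of p p'' p'] by (auto simp: is_greatest_def)
  qed
  ultimately show thesis
    using that rem by blast
qed

text \<open>Here \<open>r\<close> lies strictly below all divisors, so each multiplier \<open>c\<close> satisfies
  \<open>c lm(h) < lm(h)\<close>, that is, \<open>c < 1\<close>, and the remainder is again a partial remainder.\<close>

lemma reduce_by_previous:
  assumes "finite H"
    and H: "\<And>h D. (h, D) \<in> H \<Longrightarrow> h \<in> partial_rems \<and> h \<noteq> 0 \<and> mod_supp h \<subseteq> bounded_mons D"
    and lower: "\<And>h D p. (h, D) \<in> H \<Longrightarrow> p \<in> mod_supp r \<Longrightarrow> gt (lmon h) p"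
    and r: "r \<in> partial_rems" "mod_supp r \<subseteq> bounded_mons d"
  shows "\<exists>r'\<in>partial_rems. mod_supp r' \<subseteq> bounded_mons d \<and>
    (\<forall>p\<in>mod_supp r'. (\<exists>p'\<in>mod_supp r. p' = p \<or> gt p' p) \<and>
      (\<forall>(h, D)\<in>H. \<forall>c\<in>Mon m n. p = mon_mult c (lmon h) \<longrightarrow> d < xdeg n (snd c) + D))"
proof -
  have gr: "is_greatest gt (lmon (fst x)) (mod_supp (fst x))" if "x \<in> H" for x
    using H[of "fst x" "snd x"] that by (auto intro: lmon_greatest partial_rems_module)
  obtain q where
    q: "\<And>x c. x \<in> H \<Longrightarrow> c \<in> psp_supp (q x) \<Longrightarrow> c \<in> Mon m n \<and>
      (\<exists>p\<in>mod_supp r. p = mon_mult c (lmon (fst x)) \<or> gt p (mon_mult c (lmon (fst x))))"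
    and rem: "\<And>p. p \<in> mod_supp (r - (\<Sum>x\<in>H. q x *s fst x)) \<Longrightarrow>
      p \<in> bounded_mons d \<and> (\<exists>p'\<in>mod_supp r. p' = p \<or> gt p' p) \<and>
      (\<forall>x\<in>H. \<forall>c\<in>Mon m n. p = mon_mult c (lmon (fst x)) \<longrightarrow> d < xdeg n (snd c) + snd x)"
    by (rule determinate_division[of H fst snd "\<lambda>x. lmon (fst x)" r d]) (use H assms(1) r gr in force)+
  have "q x \<in> below_one" if "x \<in> H" for x
    unfolding below_one_def
  proof clarify
    fix c assume "c \<in> psp_supp (q x)"
    then obtain p where c: "c \<in> Mon m n" and p: "p \<in> mod_supp r"
        "p = mon_mult c (lmon (fst x)) \<or> gt p (mon_mult c (lmon (fst x)))"
      using q[OF \<open>x \<in> H\<close>] by blast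
    have L: "lmon (fst x) \<in> Mon_mod m n"
      using gr[OF \<open>x \<in> H\<close>] H[of "fst x" "snd x"] \<open>x \<in> H\<close> bounded_monsD
      unfolding is_greatest_def by (metis prod.collapse subsetD)
    have "gt (lmon (fst x)) p"
      using lower[of "fst x" "snd x"] \<open>x \<in> H\<close> p(1) by simp
    then have "gt (lmon (fst x)) (mon_mult c (lmon (fst x)))"
      using p L r(2) bounded_monsD gt_trans mon_mult_mem[OF c L] by blast
    then show "c \<in> Mon m n \<and> gt1 0 c"
      using gt_multD_small c L by blast
  qed
  then have "r - (\<Sum>x\<in>H. q x *s fst x) \<in> partial_rems"
    using assms(1) r(1) H by (intro partial_rems_diff_sum_below_one) (metis prod.collapse)+
  with rem show ?thesis
    by (intro bexI[of _ "r - (\<Sum>x\<in>H. q x *s fst x)"]) (auto simp: case_prod_beta)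
qed

text \<open>A state consists of the earlier partial remainders with their degree bounds, and the
  current one, which lies strictly below the earlier ones and whose leading monomial cannot be
  reduced by them within its own degree bound. If every partial remainder is reducible by a generator,
  states can be extended forever, and the resulting sequence is ruled out by Dickson's lemma.\<close>

lemma ex_irreducible:
  "\<exists>r\<in>partial_rems. r = 0 \<or> (\<forall>j<k. \<not> lm_dvd m n (lm gt (g j)) (lm gt r))"
proof (rule ccontr)
  assume "\<not> ?thesis"
  then have red: "r \<noteq> 0" "\<exists>j<k. lm_dvd m n (lm gt (g j)) (lm gt r)" if "r \<in> partial_rems" for r
    using that by auto
  define mora_state where "mora_state H r d \<longleftrightarrow> finite H \<and>
      (\<forall>(h, D)\<in>H. h \<in> partial_rems \<and> mod_supp h \<subseteq> bounded_mons D \<and> (\<forall>p\<in>mod_supp r. gt (lmon h) p) \<and>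
        (\<forall>c\<in>Mon m n. lmon r = mon_mult c (lmon h) \<longrightarrow> d < xdeg n (snd c) + D)) \<and>
      r \<in> partial_rems \<and> mod_supp r \<subseteq> bounded_mons d"
    for H :: "(('k psp ^ 's) \<times> nat) set" and r d
  have next_step: "\<exists>r' d'. mora_state (insert (r, d) H) r' d'" if "mora_state H r d" for H r d
  proof -
    have r: "r \<in> partial_rems" "r \<noteq> 0" "mod_supp r \<subseteq> bounded_mons d"
      using that red(1) by (auto simp: mora_state_def)
    have lr: "lm gt r = Some (lmon r)" "is_greatest gt (lmon r) (mod_supp r)"
      using r lmon partial_rems_module by auto
    obtain j where j: "j < k" "lm_dvd m n (lm gt (g j)) (lm gt r)"
      using red(2)[OF r(1)] by blast
    have "g j \<noteq> 0"
      using j(2) lr(1) by (auto simp: lm_def greatest_mon_def)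
    then have lg: "lm gt (g j) = Some (lmon (g j))" "is_greatest gt (lmon (g j)) (mod_supp (g j))"
      using lmon g j(1) by auto
    obtain c where c: "c \<in> Mon m n" "lmon r = mon_mult c (lmon (g j))"
      using j(2) lr(1) lg(1) by (auto simp: mon_dvd_def)
    obtain r1 d1 where r1: "r1 \<in> partial_rems" "mod_supp r1 \<subseteq> bounded_mons d1"
        "\<And>p. p \<in> mod_supp r1 \<Longrightarrow> gt (lmon r) p"
      using reduce_by_generator[OF r(1,3) lr(2) j(1) lg(2) c] by blast
    let ?H = "insert (r, d) H"
    have H: "h \<in> partial_rems \<and> h \<noteq> 0 \<and> mod_supp h \<subseteq> bounded_mons D" if "(h, D) \<in> ?H" for h D
      using that \<open>mora_state H r d\<close> r red(1)[of h] unfolding mora_state_def by blast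
    have lower: "gt (lmon h) p" if "(h, D) \<in> ?H" "p \<in> mod_supp r1" for h D p
    proof (cases "(h, D) \<in> H")
      case True
      have "lmon h \<in> mod_supp h" "lmon r \<in> mod_supp r"
        using lmon_greatest H[OF that(1)] lr(2) partial_rems_module by (auto simp: is_greatest_def)
      then have "lmon h \<in> Mon_mod m n" "lmon r \<in> Mon_mod m n" "p \<in> Mon_mod m n"
        using H[OF that(1)] r(3) r1(2) that(2) bounded_monsD by blast+
      moreover have "gt (lmon h) (lmon r)"
        using True \<open>mora_state H r d\<close> \<open>lmon r \<in> mod_supp r\<close> by (auto simp: mora_state_def)
      ultimately show ?thesis
        using r1(3)[OF that(2)] gt_trans by blast
    qed (use that r1(3) in auto)
    have fin: "finite ?H"
      using \<open>mora_state H r d\<close> by (simp add: mora_state_def)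
    have "\<exists>r2\<in>partial_rems. mod_supp r2 \<subseteq> bounded_mons d1 \<and>
      (\<forall>p\<in>mod_supp r2. (\<exists>p'\<in>mod_supp r1. p' = p \<or> gt p' p) \<and>
        (\<forall>(h, D)\<in>?H. \<forall>c\<in>Mon m n. p = mon_mult c (lmon h) \<longrightarrow> d1 < xdeg n (snd c) + D))"
      by (rule reduce_by_previous[OF fin _ _ r1(1,2)]) (use H lower in blast)+
    then obtain r2 where r2: "r2 \<in> partial_rems" "mod_supp r2 \<subseteq> bounded_mons d1"
      and r2': "\<forall>p\<in>mod_supp r2. (\<exists>p'\<in>mod_supp r1. p' = p \<or> gt p' p) \<and>
        (\<forall>(h, D)\<in>?H. \<forall>c\<in>Mon m n. p = mon_mult c (lmon h) \<longrightarrow> d1 < xdeg n (snd c) + D)"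
      by (elim bexE conjE)
    have mem: "lmon r2 \<in> mod_supp r2"
      using lmon_greatest r2(1) red(1) partial_rems_module by (auto simp: is_greatest_def)
    have "mora_state ?H r2 d1"
      unfolding mora_state_def
    proof (intro conjI fin r2 ballI, clarify, intro conjI ballI impI)
      fix h D assume hD: "(h, D) \<in> ?H"
      show "h \<in> partial_rems" "mod_supp h \<subseteq> bounded_mons D"
        using H[OF hD] by auto
      fix p assume p: "p \<in> mod_supp r2"
      obtain p' where p': "p' \<in> mod_supp r1" "p' = p \<or> gt p' p"
        using r2' p by blast
      have "lmon h \<in> mod_supp h"
        using lmon_greatest H[OF hD] partial_rems_module by (auto simp: is_greatest_def)
      then have "lmon h \<in> Mon_mod m n" "p \<in> Mon_mod m n" "p' \<in> Mon_mod m n"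
        using H[OF hD] r1(2) r2(2) p p'(1) bounded_monsD by blast+
      then show "gt (lmon h) p"
        using p' lower[OF hD p'(1)] gt_trans by blast
    next
      fix h D c assume "(h, D) \<in> ?H" "c \<in> Mon m n" "lmon r2 = mon_mult c (lmon h)"
      with r2' mem show "d1 < xdeg n (snd c) + D"
        by fastforce
    qed
    then show ?thesis
      by blast
  qed
  obtain d0 where "mod_supp f \<subseteq> bounded_mons d0"
    using ex_bounded_mons f by blast
  then have start: "mora_state {} f d0"
    using f_in_partial_rems by (simp add: mora_state_def)
  define ok where "ok x \<longleftrightarrow> mora_state (fst x) (fst (snd x)) (snd (snd x))" for x
  have "\<exists>S. \<forall>i. ok (S i) \<and> fst (S (Suc i)) = insert (snd (S i)) (fst (S i))"
  proof (rule dependent_nat_choice)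
    show "\<exists>x. ok x"
      using start by (intro exI[of _ "({}, f, d0)"]) (simp add: ok_def)
    fix x and i :: nat assume "ok x"
    then obtain r' d' where "mora_state (insert (snd x) (fst x)) r' d'"
      using next_step[of "fst x" "fst (snd x)" "snd (snd x)"] by (auto simp: ok_def)
    then show "\<exists>y. ok y \<and> fst y = insert (snd x) (fst x)"
      by (intro exI[of _ "(insert (snd x) (fst x), r', d')"]) (simp add: ok_def)
  qed
  then obtain S where S: "\<And>i. ok (S i)" "\<And>i. fst (S (Suc i)) = insert (snd (S i)) (fst (S i))"
    by metis
  define r where "r i = fst (snd (S i))" for i
  define d where "d i = snd (snd (S i))" for i
  have S': "mora_state (fst (S i)) (r i) (d i)" for i
    using S(1)[of i] by (simp add: r_def d_def ok_def)
  have mem: "(r i, d i) \<in> fst (S j)" if "i < j" for i j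
    using that by (induction j) (auto simp: S(2) less_Suc_eq r_def d_def)
  have rN: "r i \<in> partial_rems" "mod_supp (r i) \<subseteq> bounded_mons (d i)" for i
    using S'[of i] by (auto simp: mora_state_def)
  have lead: "lmon (r i) \<in> bounded_mons (d i)" for i
    using lmon_greatest[of "r i"] rN red(1) partial_rems_module by (auto simp: is_greatest_def)
  define \<alpha> where "\<alpha> i = fst (fst (lmon (r i)))" for i
  define \<beta> where "\<beta> i = snd (fst (lmon (r i)))" for i
  have \<alpha>\<beta>: "\<alpha> i \<in> expos m" "\<beta> i \<in> expos n" "xdeg n (\<beta> i) \<le> d i" for i
    using lead[of i] by (auto simp: bounded_mons_def Mon_mod_def Mon_def \<alpha>_def \<beta>_def mem_Times_iff)
  \<comment> \<open>Coordinates for Dickson's lemma: the ecart and the exponents of \<open>t\<close> and \<open>x\<close> in the leading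
    monomial. The ecart is the exponent of a homogenizing variable for \<open>x\<close>.\<close>
  define a where "a l i = (case l of None \<Rightarrow> d i - xdeg n (\<beta> i)
      | Some (Inl l) \<Rightarrow> Poly_Mapping.lookup (\<alpha> i) l
      | Some (Inr l) \<Rightarrow> Poly_Mapping.lookup (\<beta> i) l)" for l :: "(nat + nat) option" and i
  obtain i j where ij: "i < j" "snd (lmon (r i)) = snd (lmon (r j))"
    and le: "\<And>l. l \<in> insert None (Some ` ({..<m} <+> {..<n})) \<Longrightarrow> a l i \<le> a l j"
    by (rule Dickson_sequence[of "insert None (Some ` ({..<m} <+> {..<n}))" "\<lambda>i. snd (lmon (r i))" a])
      auto
  have \<alpha>: "\<alpha> j - \<alpha> i + \<alpha> i = \<alpha> j"
    using le[of "Some (Inl _)"] by (intro expo_diff_add[OF \<alpha>\<beta>(1)]) (auto simp: a_def)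
  have \<beta>: "\<beta> j - \<beta> i + \<beta> i = \<beta> j"
    using le[of "Some (Inr _)"] by (intro expo_diff_add[OF \<alpha>\<beta>(2)]) (auto simp: a_def)
  let ?c = "(\<alpha> j - \<alpha> i, \<beta> j - \<beta> i)"
  have "lmon (r j) = mon_mult ?c (lmon (r i))"
    using \<alpha> \<beta> ij(2) by (simp add: mon_mult_def prod_eq_iff \<alpha>_def \<beta>_def)
  moreover have "?c \<in> Mon m n"
    using \<alpha>\<beta> by (simp add: Mon_def expos_diff)
  ultimately have "d j < xdeg n (\<beta> j - \<beta> i) + d i"
    using S'[of j] mem[OF ij(1)] unfolding mora_state_def by fastforce
  moreover have "d i - xdeg n (\<beta> i) \<le> d j - xdeg n (\<beta> j)"
    using le[of None] by (simp add: a_def)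
  moreover have "xdeg n (\<beta> j - \<beta> i) + xdeg n (\<beta> i) = xdeg n (\<beta> j)"
    using \<beta> by (metis xdeg_add)
  ultimately show False
    using \<alpha>\<beta>(3)[of i] \<alpha>\<beta>(3)[of j] by linarith
qed

lemma lm_ge_if_below:
  fixes h :: "'k psp ^ 's"
  assumes "h \<in> psp_module m n" "\<And>p. p \<in> mod_supp h \<Longrightarrow> below_f p"
  shows "lm_ge gt (lm gt f) (lm gt h)"
proof (cases "h = 0")
  case True
  then show ?thesis
    by (simp add: lm_def greatest_mon_def)
next
  case False
  then have h: "lm gt h = Some (lmon h)" "lmon h \<in> mod_supp h"
    using lmon assms(1) by (auto simp: is_greatest_def)
  then have b: "below_f (lmon h)"
    using assms(2) by blast
  then obtain p where p: "p \<in> mod_supp f" "p = lmon h \<or> gt p (lmon h)"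
    by (auto simp: below_f_def)
  then have "f \<noteq> 0"
    by auto
  then have lf: "lm gt f = Some (lmon f)" "is_greatest gt (lmon f) (mod_supp f)"
    using lmon f by auto
  then have "lmon f = lmon h \<or> gt (lmon f) (lmon h)"
    using p b f_mon gt_trans[of "lmon f" p "lmon h"] by (auto simp: is_greatest_def below_f_def)
  with h lf show ?thesis
    by simp
qed

lemma weak_division:
  "\<exists>u\<in>S_gt m n gt1. \<exists>q r.
    (\<forall>j<k. q j \<in> psp_ring m n) \<and> r \<in> psp_module m n \<and>
    u *s f = (\<Sum>j<k. q j *s g j) + r \<and>
    (\<forall>j<k. lm_ge gt (lm gt f) (lm gt (q j *s g j))) \<and>
    (r \<noteq> 0 \<longrightarrow> (\<forall>j<k. \<not> lm_dvd m n (lm gt (g j)) (lm gt r)))"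
proof -
  obtain r where r: "r \<in> partial_rems" "r = 0 \<or> (\<forall>j<k. \<not> lm_dvd m n (lm gt (g j)) (lm gt r))"
    using ex_irreducible by blast
  then obtain b where b: "b \<in> below_one" "f + b *s f - r \<in> low_combos"
    by (auto simp: partial_rems_def)
  obtain q where q: "f + b *s f - r = (\<Sum>j<k. q j *s g j)"
      "\<And>j. j < k \<Longrightarrow> q j \<in> psp_ring m n" "\<And>j p. j < k \<Longrightarrow> p \<in> mod_supp (q j *s g j) \<Longrightarrow> below_f p"
    using b(2) unfolding low_combos_def by blast
  have "(1 + b) *s f = (\<Sum>j<k. q j *s g j) + r"
    by (simp add: q(1)[symmetric] vector_sadd_rdistrib)
  moreover have "lm_ge gt (lm gt f) (lm gt (q j *s g j))" if "j < k" for j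
    using q(2,3)[OF that] psp_module_smult[OF _ g[OF that]] by (intro lm_ge_if_below)
  ultimately show ?thesis
    using one_plus_below_one_in_S_gt[OF b(1)] q(2) r partial_rems_module by blast
qed

end

theorem theorem3p3:
  fixes m n k :: nat
    and gt :: "mon \<times> 's::finite \<Rightarrow> mon \<times> 's \<Rightarrow> bool"
    and gt1 :: "mon \<Rightarrow> mon \<Rightarrow> bool"
    and f :: "'k::field psp ^ 's"
    and g :: "nat \<Rightarrow> 'k psp ^ 's"
  assumes "module_monomial_ordering m n gt"
    and "induced_ordering m n gt gt1"
    and "t_local m gt1"
    and "\<And>j. j < k \<Longrightarrow> g j \<in> psp_module m n"
    and "f \<in> psp_module m n"
  shows "\<exists>u\<in>S_gt m n gt1. \<exists>q r.
    (\<forall>j<k. q j \<in> psp_ring m n) \<and> r \<in> psp_module m n \<and>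
    u *s f = (\<Sum>j<k. q j *s g j) + r \<and>
    (\<forall>j<k. lm_ge gt (lm gt f) (lm gt (q j *s g j))) \<and>
    (r \<noteq> 0 \<longrightarrow> (\<forall>j<k. \<not> lm_dvd m n (lm gt (g j)) (lm gt r)))"
proof -
  interpret weak_division_setup m n gt gt1 k g f
    using assms by unfold_locales
  show ?thesis
    by (rule weak_division)
qed

end
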